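(* Let $G$ be a finitely generated group and let $n$ be a positive integer. Then $G$ is a polycyclic group if and only if $\overline{G}_{1}[x_{1},\ldots,x_{n}]$ is a finitely generated soluble group.
   Context: Let $G$ be a group, $n$ a positive integer, and $F_n$ the free group freely generated by $x_1,\ldots,x_n$. Put $G[x_1,\ldots,x_n] := G * F_n$ (free product). Each element $f(x_1,\ldots,x_n)\in G[x_1,\ldots,x_n]$ defines a map $G^n\to G$, $(t_1,\ldots,t_n)\mapsto f(t_1,\ldots,t_n)$, obtained by substituting $t_i$ for $x_i$ (i.e. applying the homomorphism $G*F_n\to G$ that is the identity on $G$ and sends $x_i$ to $t_i$). Such maps are called polynomial functions, and $\overline{G}[x_1,\ldots,x_n]$ denotes the set of all of them. It is a group under the pointwise product: the product of $(t_1,\ldots,t_n)\mapsto f(t_1,\ldots,t_n)$ and $(t_1,\ldots,t_n)\mapsto g(t_1,\ldots,t_n)$ is $(t_1,\ldots,t_n)\mapsto f(t_1,\ldots,t_n)g(t_1,\ldots,t_n)$. The subgroup $\overline{G}_1[x_1,\ldots,x_n]$ of $\overline{G}[x_1,\ldots,x_n]$ consists of the polynomial functions which send the $n$-tuple $(1,\ldots,1)$ to $1$. A Noetherian group is a group satisfying the maximal condition for its subgroups; a polycyclic group is a soluble Noetherian group. *)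

theory Defs
  imports "HOL-Algebra.Algebra"
begin

section \<open>Groups given by generators and relations\<close>

inductive word_cong :: "'x set \<Rightarrow> ('x list \<times> 'x list) set \<Rightarrow> 'x list \<Rightarrow> 'x list \<Rightarrow> bool"
  for A R where
    refl: "w \<in> lists A \<Longrightarrow> word_cong A R w w"
  | sym: "word_cong A R u v \<Longrightarrow> word_cong A R v u"
  | trans: "word_cong A R u v \<Longrightarrow> word_cong A R v w \<Longrightarrow> word_cong A R u w"
  | rel: "(u, v) \<in> R \<Longrightarrow> u \<in> lists A \<Longrightarrow> v \<in> lists A \<Longrightarrow> p \<in> lists A \<Longrightarrow> q \<in> lists A \<Longrightarrow>
          word_cong A R (p @ u @ q) (p @ v @ q)"

definition word_class :: "'x set \<Rightarrow> ('x list \<times> 'x list) set \<Rightarrow> 'x list \<Rightarrow> 'x list set" where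
  "word_class A R w = {v. word_cong A R w v}"

text \<open>The monoid with generators \<open>A\<close> and defining relations \<open>u = v\<close> for \<open>(u, v) \<in> R\<close>.\<close>

definition presented_monoid :: "'x set \<Rightarrow> ('x list \<times> 'x list) set \<Rightarrow> 'x list set monoid" where
  "presented_monoid A R =
     \<lparr>carrier = word_class A R ` lists A,
      monoid.mult = (\<lambda>U V. (\<Union>u\<in>U. \<Union>v\<in>V. word_class A R (u @ v))),
      one = word_class A R []\<rparr>"


section \<open>Free groups and free products\<close>

text \<open>The letter \<open>(i, True)\<close> is the generator with index \<open>i\<close>, and \<open>(i, False)\<close> is its inverse.\<close>

definition free_group_rels :: "'i set \<Rightarrow> (('i \<times> bool) list \<times> ('i \<times> bool) list) set" where
  "free_group_rels I = {([(i, b), (i, \<not> b)], []) | i b. i \<in> I}"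

definition free_group :: "'i set \<Rightarrow> ('i \<times> bool) list set monoid" where
  "free_group I = presented_monoid (I \<times> UNIV) (free_group_rels I)"

definition free_gen :: "'i set \<Rightarrow> 'i \<Rightarrow> ('i \<times> bool) list set" where
  "free_gen I i = word_class (I \<times> UNIV) (free_group_rels I) [(i, True)]"

text \<open>The free product is presented by all elements of both factors, subject to the
  multiplication tables of the factors.\<close>

definition free_product_rels ::
    "('a, 'c) monoid_scheme \<Rightarrow> ('b, 'd) monoid_scheme \<Rightarrow> (('a + 'b) list \<times> ('a + 'b) list) set" where
  "free_product_rels G H =
     {([Inl a, Inl b], [Inl (a \<otimes>\<^bsub>G\<^esub> b)]) | a b. a \<in> carrier G \<and> b \<in> carrier G} \<union>
     {([Inr a, Inr b], [Inr (a \<otimes>\<^bsub>H\<^esub> b)]) | a b. a \<in> carrier H \<and> b \<in> carrier H} \<union>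
     {([Inl \<one>\<^bsub>G\<^esub>], []), ([Inr \<one>\<^bsub>H\<^esub>], [])}"

definition free_product ::
    "('a, 'c) monoid_scheme \<Rightarrow> ('b, 'd) monoid_scheme \<Rightarrow> ('a + 'b) list set monoid" where
  "free_product G H = presented_monoid (carrier G <+> carrier H) (free_product_rels G H)"

definition free_product_inl ::
    "('a, 'c) monoid_scheme \<Rightarrow> ('b, 'd) monoid_scheme \<Rightarrow> 'a \<Rightarrow> ('a + 'b) list set" where
  "free_product_inl G H a = word_class (carrier G <+> carrier H) (free_product_rels G H) [Inl a]"

definition free_product_inr ::
    "('a, 'c) monoid_scheme \<Rightarrow> ('b, 'd) monoid_scheme \<Rightarrow> 'b \<Rightarrow> ('a + 'b) list set" where
  "free_product_inr G H b = word_class (carrier G <+> carrier H) (free_product_rels G H) [Inr b]"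


section \<open>Polynomial functions\<close>

type_synonym 'a group_poly = "('a + (nat \<times> bool) list set) list set"

definition poly_group :: "('a, 'c) monoid_scheme \<Rightarrow> nat \<Rightarrow> 'a group_poly monoid" where
  "poly_group G n = free_product G (free_group {1..n})"

definition poly_const :: "('a, 'c) monoid_scheme \<Rightarrow> nat \<Rightarrow> 'a \<Rightarrow> 'a group_poly" where
  "poly_const G n = free_product_inl G (free_group {1..n})"

definition poly_var :: "('a, 'c) monoid_scheme \<Rightarrow> nat \<Rightarrow> nat \<Rightarrow> 'a group_poly" where
  "poly_var G n i = free_product_inr G (free_group {1..n}) (free_gen {1..n} i)"

definition tuples :: "('a, 'c) monoid_scheme \<Rightarrow> nat \<Rightarrow> (nat \<Rightarrow> 'a) set" where
  "tuples G n = {1..n} \<rightarrow>\<^sub>E carrier G"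

text \<open>Existence and uniqueness of the substitution homomorphism are shown in
  \<open>substitution_unique\<close> below; extensionality only fixes its values outside the carrier.\<close>

definition is_substitution ::
    "('a, 'c) monoid_scheme \<Rightarrow> nat \<Rightarrow> (nat \<Rightarrow> 'a) \<Rightarrow> ('a group_poly \<Rightarrow> 'a) \<Rightarrow> bool" where
  "is_substitution G n t h \<longleftrightarrow>
     h \<in> hom (poly_group G n) G \<and> h \<in> extensional (carrier (poly_group G n)) \<and>
     (\<forall>g\<in>carrier G. h (poly_const G n g) = g) \<and> (\<forall>i\<in>{1..n}. h (poly_var G n i) = t i)"

definition substitution ::
    "('a, 'c) monoid_scheme \<Rightarrow> nat \<Rightarrow> (nat \<Rightarrow> 'a) \<Rightarrow> 'a group_poly \<Rightarrow> 'a" where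
  "substitution G n t = (THE h. is_substitution G n t h)"

definition poly_fun :: "('a, 'c) monoid_scheme \<Rightarrow> nat \<Rightarrow> 'a group_poly \<Rightarrow> (nat \<Rightarrow> 'a) \<Rightarrow> 'a" where
  "poly_fun G n f = (\<lambda>t\<in>tuples G n. substitution G n t f)"

text \<open>\<open>product_group (tuples G n) (\<lambda>_. G)\<close> is the group of all functions from \<open>tuples G n\<close> to
  \<open>carrier G\<close> under the pointwise product.\<close>

definition poly_fun_group :: "('a, 'c) monoid_scheme \<Rightarrow> nat \<Rightarrow> ((nat \<Rightarrow> 'a) \<Rightarrow> 'a) monoid" where
  "poly_fun_group G n =
     (product_group (tuples G n) (\<lambda>_. G))\<lparr>carrier := poly_fun G n ` carrier (poly_group G n)\<rparr>"

definition poly_fun_group1 :: "('a, 'c) monoid_scheme \<Rightarrow> nat \<Rightarrow> ((nat \<Rightarrow> 'a) \<Rightarrow> 'a) monoid" where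
  "poly_fun_group1 G n =
     (poly_fun_group G n)
       \<lparr>carrier := {p \<in> carrier (poly_fun_group G n). p (\<lambda>i\<in>{1..n}. \<one>\<^bsub>G\<^esub>) = \<one>\<^bsub>G\<^esub>}\<rparr>"


section \<open>Finiteness conditions\<close>

definition finitely_generated_group :: "('a, 'c) monoid_scheme \<Rightarrow> bool" where
  "finitely_generated_group G \<longleftrightarrow> (\<exists>S. finite S \<and> S \<subseteq> carrier G \<and> generate G S = carrier G)"

definition noetherian_group :: "('a, 'c) monoid_scheme \<Rightarrow> bool" where
  "noetherian_group G \<longleftrightarrow>
     (\<forall>\<S>. \<S> \<noteq> {} \<and> (\<forall>H\<in>\<S>. subgroup H G) \<longrightarrow> (\<exists>M\<in>\<S>. \<forall>H\<in>\<S>. M \<subseteq> H \<longrightarrow> H = M))"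

definition polycyclic_group :: "('a, 'c) monoid_scheme \<Rightarrow> bool" where
  "polycyclic_group G \<longleftrightarrow> solvable G \<and> noetherian_group G"


section \<open>Presented monoids: universal property\<close>

lemma word_cong_lists:
  assumes "word_cong A R u v" shows "u \<in> lists A" "v \<in> lists A"
  using assms by (induction) auto

lemma word_cong_append_left:
  assumes "word_cong A R u v" "p \<in> lists A" shows "word_cong A R (p @ u) (p @ v)"
  using assms(1)
proof (induction)
  case (rel u v r q)
  then show ?case using word_cong.rel[of u v R A "p @ r" q] assms(2) by simp
next
  case (refl w)
  then show ?case using assms(2) by (intro word_cong.refl) auto
qed (metis word_cong.sym, metis word_cong.trans)

lemma word_cong_append_right:
  assumes "word_cong A R u v" "q \<in> lists A" shows "word_cong A R (u @ q) (v @ q)"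
  using assms(1)
proof (induction)
  case (rel u v p r)
  then show ?case using word_cong.rel[of u v R A p "r @ q"] assms(2) by simp
next
  case (refl w)
  then show ?case using assms(2) by (intro word_cong.refl) auto
qed (metis word_cong.sym, metis word_cong.trans)

lemma word_cong_append:
  assumes "word_cong A R u u'" "word_cong A R v v'"
  shows "word_cong A R (u @ v) (u' @ v')"
  using word_cong_append_left[OF assms(2)] word_cong_append_right[OF assms(1)]
    word_cong_lists[OF assms(1)] word_cong_lists[OF assms(2)]
  by (meson word_cong.trans)

lemma word_class_eqI: "word_cong A R u v \<Longrightarrow> word_class A R u = word_class A R v"
  unfolding word_class_def by (blast intro: word_cong.sym word_cong.trans)

lemma word_class_self: "w \<in> lists A \<Longrightarrow> w \<in> word_class A R w"
  unfolding word_class_def by (simp add: word_cong.refl)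

lemma word_class_rel:
  "(u, v) \<in> R \<Longrightarrow> u \<in> lists A \<Longrightarrow> v \<in> lists A \<Longrightarrow> word_class A R u = word_class A R v"
  using word_cong.rel[of u v R A "[]" "[]"] by (intro word_class_eqI) simp

lemma carrier_presented_monoid: "carrier (presented_monoid A R) = word_class A R ` lists A"
  by (simp add: presented_monoid_def)

lemma one_presented_monoid: "\<one>\<^bsub>presented_monoid A R\<^esub> = word_class A R []"
  by (simp add: presented_monoid_def)

lemma mult_presented_monoid:
  assumes "u \<in> lists A" "v \<in> lists A"
  shows "word_class A R u \<otimes>\<^bsub>presented_monoid A R\<^esub> word_class A R v = word_class A R (u @ v)"
proof -
  have "word_class A R (u' @ v') = word_class A R (u @ v)"
    if "u' \<in> word_class A R u" "v' \<in> word_class A R v" for u' v'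
    using that by (intro word_class_eqI word_cong.sym[OF word_cong_append])
      (auto simp: word_class_def)
  then have "(\<Union>u'\<in>word_class A R u. \<Union>v'\<in>word_class A R v. word_class A R (u' @ v')) =
    (\<Union>u'\<in>word_class A R u. \<Union>v'\<in>word_class A R v. word_class A R (u @ v))"
    by (intro SUP_cong HOL.refl)
  also have "\<dots> = word_class A R (u @ v)"
    using word_class_self[OF assms(1)] word_class_self[OF assms(2)] by auto
  finally show ?thesis by (simp add: presented_monoid_def)
qed

lemma monoid_presented_monoid: "monoid (presented_monoid A R)"
  by (rule monoidI) (auto simp: carrier_presented_monoid one_presented_monoid mult_presented_monoid
      simp del: in_lists_conv_set del: in_listsD)

lemma group_presented_monoid:
  assumes "\<And>a. a \<in> A \<Longrightarrow> \<exists>b\<in>A. word_class A R [b, a] = word_class A R []"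
  shows "group (presented_monoid A R)"
proof (rule groupI)
  fix Z assume "Z \<in> carrier (presented_monoid A R)"
  then obtain w where w: "w \<in> lists A" "Z = word_class A R w"
    by (auto simp: carrier_presented_monoid)
  have "\<exists>v\<in>lists A. word_class A R (v @ w) = word_class A R []"
    using w(1)
  proof (induction w)
    case Nil then show ?case by (intro bexI[of _ "[]"]) auto
  next
    case (Cons a w)
    obtain v where v: "v \<in> lists A" "word_class A R (v @ w) = word_class A R []"
      using Cons.IH by blast
    obtain b where b: "b \<in> A" "word_class A R [b, a] = word_class A R []"
      using assms Cons.hyps by blast
    have "word_class A R ((v @ [b]) @ a # w)
        = word_class A R v \<otimes>\<^bsub>presented_monoid A R\<^esub> (word_class A R [b, a] \<otimes>\<^bsub>presented_monoid A R\<^esub> word_class A R w)"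
      using Cons.hyps v(1) b(1) by (simp add: mult_presented_monoid del: in_lists_conv_set)
    also have "\<dots> = word_class A R []"
      using Cons.hyps v b by (simp add: mult_presented_monoid del: in_lists_conv_set)
    finally show ?case using v(1) b(1) by (intro bexI[of _ "v @ [b]"]) auto
  qed
  then show "\<exists>Y\<in>carrier (presented_monoid A R). Y \<otimes>\<^bsub>presented_monoid A R\<^esub> Z = \<one>\<^bsub>presented_monoid A R\<^esub>"
    using w by (auto simp: carrier_presented_monoid one_presented_monoid mult_presented_monoid
      simp del: in_lists_conv_set del: in_listsD)
qed (auto simp: carrier_presented_monoid one_presented_monoid mult_presented_monoid
      simp del: in_lists_conv_set del: in_listsD)

definition eval_word :: "('b, 'c) monoid_scheme \<Rightarrow> ('x \<Rightarrow> 'b) \<Rightarrow> 'x list \<Rightarrow> 'b" where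
  "eval_word K f w = foldr (\<lambda>x y. f x \<otimes>\<^bsub>K\<^esub> y) w \<one>\<^bsub>K\<^esub>"

context group
begin

lemma eval_word_closed: "f \<in> A \<rightarrow> carrier G \<Longrightarrow> w \<in> lists A \<Longrightarrow> eval_word G f w \<in> carrier G"
  by (induction w) (auto simp: eval_word_def)

lemma eval_word_append:
  assumes "f \<in> A \<rightarrow> carrier G" "u \<in> lists A" "v \<in> lists A"
  shows "eval_word G f (u @ v) = eval_word G f u \<otimes> eval_word G f v"
  using assms(2)
proof (induction u)
  case Nil
  then show ?case using eval_word_closed[OF assms(1,3)] by (simp add: eval_word_def)
next
  case (Cons a u)
  then show ?case
    using eval_word_closed[OF assms(1), of u] eval_word_closed[OF assms(1,3)] assms(1)
    by (auto simp: eval_word_def m_assoc Pi_iff)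
qed

lemma eval_word_cong:
  assumes "f \<in> A \<rightarrow> carrier G"
    and "\<And>u v. (u, v) \<in> R \<Longrightarrow> eval_word G f u = eval_word G f v"
    and "word_cong A R u v"
  shows "eval_word G f u = eval_word G f v"
  using assms(3) by (induction) (simp_all add: eval_word_append[OF assms(1)] assms(2))

lemma presented_monoid_lift:
  assumes f: "f \<in> A \<rightarrow> carrier G"
    and R: "\<And>u v. (u, v) \<in> R \<Longrightarrow> eval_word G f u = eval_word G f v"
  shows "\<exists>h\<in>hom (presented_monoid A R) G. \<forall>a\<in>A. h (word_class A R [a]) = f a"
proof -
  define h where "h Z = eval_word G f (SOME w. w \<in> Z)" for Z
  have h: "h (word_class A R w) = eval_word G f w" if "w \<in> lists A" for w
  proof -
    have "(SOME v. v \<in> word_class A R w) \<in> word_class A R w"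
      using word_class_self[OF that] by (rule someI)
    then show ?thesis
      using eval_word_cong[OF f R] by (auto simp: h_def word_class_def)
  qed
  have "h \<in> hom (presented_monoid A R) G"
    by (rule homI) (auto simp: carrier_presented_monoid mult_presented_monoid h
        eval_word_closed[OF f] eval_word_append[OF f]
        simp del: in_lists_conv_set del: in_listsD)
  moreover have "\<forall>a\<in>A. h (word_class A R [a]) = f a"
    using f by (auto simp: h eval_word_def Pi_iff)
  ultimately show ?thesis by blast
qed

end

lemma presented_monoid_hom_unique:
  assumes "group (presented_monoid A R)" "group K"
    and "h \<in> hom (presented_monoid A R) K" "k \<in> hom (presented_monoid A R) K"
    and "\<And>a. a \<in> A \<Longrightarrow> h (word_class A R [a]) = k (word_class A R [a])"
    and "Z \<in> carrier (presented_monoid A R)"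
  shows "h Z = k Z"
proof -
  obtain w where w: "w \<in> lists A" "Z = word_class A R w"
    using assms(6) by (auto simp: carrier_presented_monoid)
  have "h (word_class A R w) = k (word_class A R w)" using w(1)
  proof (induction w)
    case Nil
    then show ?case
      using hom_one[OF assms(3,1,2)] hom_one[OF assms(4,1,2)] by (simp add: one_presented_monoid)
  next
    case (Cons a w)
    have c: "word_class A R [a] \<in> carrier (presented_monoid A R)"
      "word_class A R w \<in> carrier (presented_monoid A R)"
      using Cons.hyps by (auto simp: carrier_presented_monoid)
    have "word_class A R (a # w) = word_class A R [a] \<otimes>\<^bsub>presented_monoid A R\<^esub> word_class A R w"
      using Cons.hyps by (simp add: mult_presented_monoid)
    then show ?case
      using hom_mult[OF assms(3) c] hom_mult[OF assms(4) c] assms(5) Cons by simp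
  qed
  then show ?thesis by (simp add: w)
qed


section \<open>Free groups and free products: universal properties\<close>

lemma group_free_group: "group (free_group I)"
  unfolding free_group_def
proof (rule group_presented_monoid)
  fix a :: "'a \<times> bool" assume "a \<in> I \<times> UNIV"
  then obtain i b where a: "a = (i, b)" "i \<in> I" by auto
  have "([(i, \<not> b), (i, \<not> \<not> b)], []) \<in> free_group_rels I"
    unfolding free_group_rels_def using a by blast
  then have "word_class (I \<times> UNIV) (free_group_rels I) [(i, \<not> b), (i, b)]
      = word_class (I \<times> UNIV) (free_group_rels I) []"
    using a by (intro word_class_rel) auto
  then show "\<exists>b\<in>I \<times> UNIV. word_class (I \<times> UNIV) (free_group_rels I) [b, a]
      = word_class (I \<times> UNIV) (free_group_rels I) []"
    using a by blast
qed

lemma free_gen_closed: "i \<in> I \<Longrightarrow> free_gen I i \<in> carrier (free_group I)"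
  by (auto simp: free_gen_def free_group_def carrier_presented_monoid)

lemma free_group_lift:
  assumes "group K" "t \<in> I \<rightarrow> carrier K"
  shows "\<exists>h\<in>hom (free_group I) K. \<forall>i\<in>I. h (free_gen I i) = t i"
proof -
  interpret K: group K by fact
  define f where "f = (\<lambda>(i, b). if b then t i else inv\<^bsub>K\<^esub> t i)"
  have f: "f \<in> I \<times> UNIV \<rightarrow> carrier K" using assms(2) by (auto simp: f_def Pi_iff)
  have "\<exists>h\<in>hom (free_group I) K. \<forall>a\<in>I \<times> UNIV.
      h (word_class (I \<times> UNIV) (free_group_rels I) [a]) = f a"
    unfolding free_group_def
    by (rule K.presented_monoid_lift[OF f])
       (use assms(2) in \<open>auto simp: free_group_rels_def eval_word_def f_def Pi_iff\<close>)
  then obtain h where h: "h \<in> hom (free_group I) K"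
      "\<And>a. a \<in> I \<times> UNIV \<Longrightarrow> h (word_class (I \<times> UNIV) (free_group_rels I) [a]) = f a"
    by blast
  show ?thesis
    by (rule bexI[OF _ h(1)]) (simp add: free_gen_def h(2) f_def)
qed

lemma free_group_hom_unique:
  assumes "group K" "h \<in> hom (free_group I) K" "k \<in> hom (free_group I) K"
    and "\<And>i. i \<in> I \<Longrightarrow> h (free_gen I i) = k (free_gen I i)" "Z \<in> carrier (free_group I)"
  shows "h Z = k Z"
proof -
  interpret K: group K by fact
  interpret F: group "free_group I" by (rule group_free_group)
  interpret h: group_hom "free_group I" K h using assms(2) by unfold_locales
  interpret k: group_hom "free_group I" K k using assms(3) by unfold_locales
  let ?c = "word_class (I \<times> UNIV) (free_group_rels I)"
  show ?thesis
  proof (rule presented_monoid_hom_unique[where A = "I \<times> UNIV" and R = "free_group_rels I" and K = K,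
        folded free_group_def, OF group_free_group assms(1-3) _ assms(5)])
    fix a assume "a \<in> I \<times> (UNIV :: bool set)"
    then obtain i b where a: "a = (i, b)" "i \<in> I" by auto
    have c: "?c [(i, b)] \<in> carrier (free_group I)" for b
      using a by (auto simp: free_group_def carrier_presented_monoid)
    have "([(i, False), (i, \<not> False)], []) \<in> free_group_rels I"
      unfolding free_group_rels_def using a by blast
    then have "?c [(i, False), (i, True)] = ?c []"
      using a by (intro word_class_rel) auto
    then have "?c [(i, False)] \<otimes>\<^bsub>free_group I\<^esub> free_gen I i = \<one>\<^bsub>free_group I\<^esub>"
      using a by (simp add: free_group_def one_presented_monoid free_gen_def mult_presented_monoid)
    then have "?c [(i, False)] = inv\<^bsub>free_group I\<^esub> free_gen I i"
      using F.inv_equality c free_gen_closed[OF a(2)] by metis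
    then have "h (?c [(i, False)]) = k (?c [(i, False)])"
      using free_gen_closed[OF a(2)] assms(4)[OF a(2)] by simp
    then show "h (?c [a]) = k (?c [a])"
      using a assms(4)[OF a(2)] by (cases b) (auto simp: free_gen_def)
  qed
qed

context
  fixes G :: "('a, 'c) monoid_scheme" and H :: "('b, 'd) monoid_scheme"
  assumes G: "group G" and H: "group H"
begin

interpretation G: group G by (rule G)
interpretation H: group H by (rule H)

private abbreviation "L \<equiv> carrier G <+> carrier H"
private abbreviation "cls \<equiv> word_class L (free_product_rels G H)"

private lemma fp_rels:
  "a \<in> carrier G \<Longrightarrow> b \<in> carrier G \<Longrightarrow> cls [Inl a, Inl b] = cls [Inl (a \<otimes>\<^bsub>G\<^esub> b)]"
  "c \<in> carrier H \<Longrightarrow> d \<in> carrier H \<Longrightarrow> cls [Inr c, Inr d] = cls [Inr (c \<otimes>\<^bsub>H\<^esub> d)]"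
  "cls [Inl \<one>\<^bsub>G\<^esub>] = cls []" "cls [Inr \<one>\<^bsub>H\<^esub>] = cls []"
  by (intro word_class_rel; force simp: free_product_rels_def)+

lemma group_free_product: "group (free_product G H)"
  unfolding free_product_def
proof (rule group_presented_monoid)
  fix x assume "x \<in> L"
  then show "\<exists>y\<in>L. cls [y, x] = cls []"
  proof
    fix a assume a: "x = Inl a" "a \<in> carrier G"
    have "cls [Inl (inv\<^bsub>G\<^esub> a), Inl a] = cls []"
      using fp_rels(1)[of "inv\<^bsub>G\<^esub> a" a] fp_rels(3) a by simp
    then show ?thesis using a by (intro bexI[of _ "Inl (inv\<^bsub>G\<^esub> a)"]) auto
  next
    fix a assume a: "x = Inr a" "a \<in> carrier H"
    have "cls [Inr (inv\<^bsub>H\<^esub> a), Inr a] = cls []"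
      using fp_rels(2)[of "inv\<^bsub>H\<^esub> a" a] fp_rels(4) a by simp
    then show ?thesis using a by (intro bexI[of _ "Inr (inv\<^bsub>H\<^esub> a)"]) auto
  qed
qed

lemma free_product_inl_hom: "free_product_inl G H \<in> hom G (free_product G H)"
  by (rule homI) (auto simp: free_product_inl_def free_product_def carrier_presented_monoid
      mult_presented_monoid fp_rels InlI InrI)

lemma free_product_inr_hom: "free_product_inr G H \<in> hom H (free_product G H)"
  by (rule homI) (auto simp: free_product_inr_def free_product_def carrier_presented_monoid
      mult_presented_monoid fp_rels InlI InrI)

lemma free_product_lift:
  assumes "group K" "f \<in> hom G K" "g \<in> hom H K"
  shows "\<exists>h\<in>hom (free_product G H) K.
    (\<forall>a\<in>carrier G. h (free_product_inl G H a) = f a) \<and>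
    (\<forall>b\<in>carrier H. h (free_product_inr G H b) = g b)"
proof -
  interpret K: group K by fact
  have e: "case_sum f g \<in> L \<rightarrow> carrier K"
    using assms by (auto simp: hom_def)
  have "\<exists>h\<in>hom (free_product G H) K. \<forall>x\<in>L. h (cls [x]) = case_sum f g x"
    unfolding free_product_def
  proof (rule K.presented_monoid_lift[OF e])
    fix u v assume "(u, v) \<in> free_product_rels G H"
    then show "eval_word K (case_sum f g) u = eval_word K (case_sum f g) v"
      using hom_in_carrier[OF assms(2)] hom_in_carrier[OF assms(3)]
        hom_mult[OF assms(2)] hom_mult[OF assms(3)]
        hom_one[OF assms(2) G assms(1)] hom_one[OF assms(3) H assms(1)]
      unfolding free_product_rels_def by (auto simp: eval_word_def)
  qed
  then obtain h where h: "h \<in> hom (free_product G H) K"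
      "\<And>x. x \<in> L \<Longrightarrow> h (cls [x]) = case_sum f g x" by blast
  show ?thesis
    by (rule bexI[OF _ h(1)]) (auto simp: free_product_inl_def free_product_inr_def h(2) InlI InrI)
qed

lemma free_product_hom_unique:
  assumes "group K" "h \<in> hom (free_product G H) K" "k \<in> hom (free_product G H) K"
    and "\<And>a. a \<in> carrier G \<Longrightarrow> h (free_product_inl G H a) = k (free_product_inl G H a)"
    and "\<And>b. b \<in> carrier H \<Longrightarrow> h (free_product_inr G H b) = k (free_product_inr G H b)"
    and "Z \<in> carrier (free_product G H)"
  shows "h Z = k Z"
  using presented_monoid_hom_unique[OF group_free_product[unfolded free_product_def] assms(1)
      assms(2,3)[unfolded free_product_def] _ assms(6)[unfolded free_product_def]]
    assms(4,5) unfolding free_product_inl_def free_product_inr_def by (metis PlusE)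

end


section \<open>Polynomial functions: basic properties\<close>

context group
begin

lemma group_poly_group: "group (poly_group G n)"
  unfolding poly_group_def by (rule group_free_product[OF is_group group_free_group])

lemma substitution_unique:
  assumes "t \<in> tuples G n"
  shows "\<exists>!h. is_substitution G n t h"
proof -
  have "t \<in> {1..n} \<rightarrow> carrier G" using assms by (auto simp: tuples_def)
  from free_group_lift[OF is_group this]
  obtain k where k: "k \<in> hom (free_group {1..n}) G" "\<And>i. i \<in> {1..n} \<Longrightarrow> k (free_gen {1..n} i) = t i"
    by blast
  have "id \<in> hom G G" by (simp add: hom_def)
  then obtain h where h: "h \<in> hom (poly_group G n) G"
      "\<And>a. a \<in> carrier G \<Longrightarrow> h (poly_const G n a) = a"
      "\<And>b. b \<in> carrier (free_group {1..n}) \<Longrightarrow> h (free_product_inr G (free_group {1..n}) b) = k b"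
    using free_product_lift[OF is_group group_free_group is_group _ k(1), of id]
    unfolding poly_group_def poly_const_def by auto
  have pc: "poly_const G n a \<in> carrier (poly_group G n)" if "a \<in> carrier G" for a
    using hom_in_carrier[OF free_product_inl_hom[OF is_group group_free_group] that]
    by (simp add: poly_const_def poly_group_def)
  have pv: "poly_var G n i \<in> carrier (poly_group G n)" if "i \<in> {1..n}" for i
    using hom_in_carrier[OF free_product_inr_hom[OF is_group group_free_group] free_gen_closed[OF that]]
    by (simp add: poly_var_def poly_group_def)
  show ?thesis
  proof (rule ex1I)
    interpret P: group "poly_group G n" by (rule group_poly_group)
    show "is_substitution G n t (restrict h (carrier (poly_group G n)))"
      unfolding is_substitution_def
    proof (intro conjI ballI)
      show "restrict h (carrier (poly_group G n)) \<in> hom (poly_group G n) G"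
        using h(1) by (auto simp: hom_def)
    next
      fix i assume i: "i \<in> {1..n}"
      then have "h (poly_var G n i) = t i"
        using h(3)[OF free_gen_closed[OF i]] k(2)[OF i] by (simp add: poly_var_def)
      then show "restrict h (carrier (poly_group G n)) (poly_var G n i) = t i"
        using pv[OF i] by simp
    qed (use h(2) pc in auto)
  next
    fix g assume g: "is_substitution G n t g"
    have g1: "g \<in> hom (poly_group G n) G" using g by (simp add: is_substitution_def)
    have inr: "free_product_inr G (free_group {1..n}) \<in> hom (free_group {1..n}) (poly_group G n)"
      unfolding poly_group_def by (rule free_product_inr_hom[OF is_group group_free_group])
    have "g Z = h Z" if "Z \<in> carrier (poly_group G n)" for Z
    proof (rule free_product_hom_unique[OF is_group group_free_group is_group])
      fix b assume b: "b \<in> carrier (free_group {1..n})"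
      have "(g \<circ> free_product_inr G (free_group {1..n})) b = (h \<circ> free_product_inr G (free_group {1..n})) b"
      proof (rule free_group_hom_unique[OF is_group _ _ _ b])
        fix i assume i: "i \<in> {1..n}"
        show "(g \<circ> free_product_inr G (free_group {1..n})) (free_gen {1..n} i)
            = (h \<circ> free_product_inr G (free_group {1..n})) (free_gen {1..n} i)"
          using g i h(3)[OF free_gen_closed[OF i]] k(2)[OF i]
          by (simp add: is_substitution_def poly_var_def)
      qed (fact Group.hom_compose[OF inr g1] Group.hom_compose[OF inr h(1)])+
      then show "g (free_product_inr G (free_group {1..n}) b) = h (free_product_inr G (free_group {1..n}) b)"
        by simp
    qed (use g h that in \<open>auto simp: is_substitution_def poly_group_def poly_const_def\<close>)
    then show "g = restrict h (carrier (poly_group G n))"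
      using g by (intro extensionalityI[of _ "carrier (poly_group G n)"])
        (auto simp: is_substitution_def)
  qed
qed

lemma is_substitution_substitution:
  "t \<in> tuples G n \<Longrightarrow> is_substitution G n t (substitution G n t)"
  unfolding substitution_def by (rule theI'[of "is_substitution G n t"]) (rule substitution_unique)

lemma poly_fun_hom: "poly_fun G n \<in> hom (poly_group G n) (product_group (tuples G n) (\<lambda>_. G))"
proof (rule homI)
  note s = is_substitution_substitution[unfolded is_substitution_def]
  show "poly_fun G n f \<in> carrier (product_group (tuples G n) (\<lambda>_. G))"
    if "f \<in> carrier (poly_group G n)" for f
    using that s by (auto simp: poly_fun_def hom_def Pi_iff)
  show "poly_fun G n (f \<otimes>\<^bsub>poly_group G n\<^esub> g)
      = poly_fun G n f \<otimes>\<^bsub>product_group (tuples G n) (\<lambda>_. G)\<^esub> poly_fun G n g"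
    if "f \<in> carrier (poly_group G n)" "g \<in> carrier (poly_group G n)" for f g
    using that s by (auto simp: poly_fun_def hom_def product_group_def fun_eq_iff restrict_def)
qed

lemma subgroup_poly_fun_group:
  "subgroup (carrier (poly_fun_group G n)) (product_group (tuples G n) (\<lambda>_. G))"
proof -
  interpret group_hom "poly_group G n" "product_group (tuples G n) (\<lambda>_. G)" "poly_fun G n"
    using poly_fun_hom group_poly_group product_group is_group
    by (intro group_hom.intro group_hom_axioms.intro) auto
  show ?thesis using img_is_subgroup by (simp add: poly_fun_group_def)
qed

lemma group_poly_fun_group: "group (poly_fun_group G n)"
  using subgroup.subgroup_is_group[OF subgroup_poly_fun_group] is_group
  by (simp add: poly_fun_group_def)

lemma subgroup_poly_fun_group1:
  "subgroup (carrier (poly_fun_group1 G n)) (poly_fun_group G n)"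
proof -
  let ?e = "\<lambda>i\<in>{1..n}. \<one>" and ?P = "product_group (tuples G n) (\<lambda>_. G)"
  have e: "?e \<in> tuples G n" by (auto simp: tuples_def)
  interpret P: group ?P using is_group by simp
  have "(\<lambda>p. p ?e) \<in> hom (poly_fun_group G n) G"
  proof (rule homI)
    show "p ?e \<in> carrier G" if "p \<in> carrier (poly_fun_group G n)" for p
      using that subgroup.subset[OF subgroup_poly_fun_group, of n] e by auto
  qed (use e in \<open>simp add: poly_fun_group_def product_group_def\<close>)
  then interpret group_hom "poly_fun_group G n" G "\<lambda>p. p ?e"
    using group_poly_fun_group is_group by (intro group_hom.intro group_hom_axioms.intro) auto
  show ?thesis
    using subgroup_kernel by (simp add: kernel_def poly_fun_group1_def)
qed

lemma group_poly_fun_group1: "group (poly_fun_group1 G n)"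
  using subgroup.subgroup_is_group[OF subgroup_poly_fun_group1 group_poly_fun_group]
  by (simp add: poly_fun_group1_def)

end

end

theory Submission
  imports Defs
begin

text \<open>
  Write \<open>P\<close> for the group of polynomial functions sending the trivial tuple to \<open>1\<close>. Moving constants
  to the right in a word shows that \<open>P\<close> is generated by the functions sending \<open>t\<close> to
  \<open>g t_i g^-1\<close>, for \<open>g\<close> in \<open>G\<close> and \<open>1 \<le> i \<le> n\<close> (\<open>carrier_poly_fun_group1_eq_generate\<close>), that
  is, by the orbits of the \<open>n\<close> coordinate functions under conjugation by constants.

  Suppose that \<open>P\<close> is finitely generated and soluble. Evaluation at \<open>(s, 1, ..., 1)\<close> maps \<open>P\<close> onto
  the normal closure of \<open>s\<close> in \<open>G\<close>, so all normal closures of single elements are finitely generated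
  and soluble. As \<open>G\<close> is the product of finitely many of them, it is soluble. If a normal subgroup \<open>H\<close>
  is generated by a finite set, then its derived subgroup is the normal closure of the finitely many
  commutators of these generators, hence is finitely generated again. So all terms of the derived
  series of \<open>G\<close> are finitely generated; its factors are finitely generated abelian, and \<open>G\<close> is
  Noetherian (\<open>polycyclic_groupI\<close>).

  Suppose that \<open>G\<close> is polycyclic. Solubility of \<open>P\<close> is clear, as \<open>P\<close> lies in a direct power of \<open>G\<close>.
  The heart of the matter is finite generation. The claim is that the orbit under conjugation by
  constants of any function \<open>f\<close> from any set to \<open>G\<close> generates a finitely generated group
  (\<open>fg_subgroup_generate_conj_orbit\<close>). The proof is by induction on the derived length of a normal
  subgroup \<open>N\<close> that contains the values of \<open>f\<close>. Modulo functions with values in the derived subgroup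
  of \<open>N\<close>, finitely many conjugates of \<open>f\<close> generate all of them (\<open>conj_fun_mod_derived\<close>): the inner
  automorphisms act on the finitely generated abelian factor through finitely many coordinates, so
  Noetherianity of a finite power of \<open>G\<close> applies. Conjugating these finitely many functions by
  generators of \<open>G\<close> leaves finitely many correction terms with values in the derived subgroup, and
  these are controlled by induction.

  The group \<open>P\<close> itself need not be Noetherian, so the maximal condition is applied to finite powers
  of \<open>G\<close> and not to \<open>P\<close>.
\<close>

section \<open>Finitely generated subgroups and the maximal condition\<close>

definition fg_subgroup :: "('a, 'b) monoid_scheme \<Rightarrow> 'a set \<Rightarrow> bool" where
  "fg_subgroup G H \<longleftrightarrow> (\<exists>S. finite S \<and> S \<subseteq> carrier G \<and> generate G S = H)"

context group
begin

lemma generate_eqI: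
  assumes "A \<subseteq> carrier G" "B \<subseteq> carrier G" "A \<subseteq> generate G B" "B \<subseteq> generate G A"
  shows "generate G A = generate G B"
  using generate_subgroup_incl[OF assms(3) generate_is_subgroup[OF assms(2)]]
    generate_subgroup_incl[OF assms(4) generate_is_subgroup[OF assms(1)]] by blast

lemma finitely_generated_group_iff: "finitely_generated_group G \<longleftrightarrow> fg_subgroup G (carrier G)"
  by (simp add: finitely_generated_group_def fg_subgroup_def)

lemma finitely_generated_group_subgroup_iff:
  assumes "subgroup H G"
  shows "finitely_generated_group (G\<lparr>carrier := H\<rparr>) \<longleftrightarrow> fg_subgroup G H"
proof
  assume "finitely_generated_group (G\<lparr>carrier := H\<rparr>)"
  then obtain S where S: "finite S" "S \<subseteq> H" "generate (G\<lparr>carrier := H\<rparr>) S = H"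
    by (auto simp: finitely_generated_group_def)
  then show "fg_subgroup G H"
    using generate_consistent[OF S(2) assms] subgroup.subset[OF assms]
    unfolding fg_subgroup_def by blast
next
  assume "fg_subgroup G H"
  then obtain S where S: "finite S" "S \<subseteq> carrier G" "generate G S = H"
    by (auto simp: fg_subgroup_def)
  then have "S \<subseteq> H" using generate.incl[of _ S G] by auto
  then show "finitely_generated_group (G\<lparr>carrier := H\<rparr>)"
    using S generate_consistent[OF _ assms, of S]
    unfolding finitely_generated_group_def by auto
qed

lemma fg_subgroup_generate_Union:
  assumes "finite I" "\<And>i. i \<in> I \<Longrightarrow> A i \<subseteq> carrier G" "\<And>i. i \<in> I \<Longrightarrow> fg_subgroup G (generate G (A i))"
  shows "fg_subgroup G (generate G (\<Union>i\<in>I. A i))"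
proof -
  have "\<forall>i\<in>I. \<exists>S. finite S \<and> S \<subseteq> carrier G \<and> generate G S = generate G (A i)"
    using assms(3) by (simp add: fg_subgroup_def)
  then obtain S where S: "\<And>i. i \<in> I \<Longrightarrow> finite (S i)" "\<And>i. i \<in> I \<Longrightarrow> S i \<subseteq> carrier G"
      "\<And>i. i \<in> I \<Longrightarrow> generate G (S i) = generate G (A i)" by metis
  have "generate G (\<Union>i\<in>I. S i) = generate G (\<Union>i\<in>I. A i)"
  proof (rule generate_eqI)
    show "(\<Union>i\<in>I. S i) \<subseteq> generate G (\<Union>i\<in>I. A i)"
    proof (rule UN_least)
      fix i assume i: "i \<in> I"
      have "S i \<subseteq> generate G (A i)" using S(3)[OF i] generate.incl[of _ "S i" G] by auto
      also have "\<dots> \<subseteq> generate G (\<Union>i\<in>I. A i)" using i by (intro mono_generate) auto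
      finally show "S i \<subseteq> generate G (\<Union>i\<in>I. A i)" .
    qed
    show "(\<Union>i\<in>I. A i) \<subseteq> generate G (\<Union>i\<in>I. S i)"
    proof (rule UN_least)
      fix i assume i: "i \<in> I"
      have "A i \<subseteq> generate G (S i)" using S(3)[OF i] generate.incl[of _ "A i" G] by auto
      also have "\<dots> \<subseteq> generate G (\<Union>i\<in>I. S i)" using i by (intro mono_generate) auto
      finally show "A i \<subseteq> generate G (\<Union>i\<in>I. S i)" .
    qed
  qed (use S(2) assms(2) in auto)
  moreover have "finite (\<Union>i\<in>I. S i)" "(\<Union>i\<in>I. S i) \<subseteq> carrier G" using S(1,2) assms(1) by auto
  ultimately show ?thesis unfolding fg_subgroup_def by blast
qed

lemma fg_subgroup_generate_finite: "finite S \<Longrightarrow> S \<subseteq> carrier G \<Longrightarrow> fg_subgroup G (generate G S)"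
  unfolding fg_subgroup_def by blast

lemma generate_finite_support:
  assumes "x \<in> generate G A"
  shows "\<exists>Y. finite Y \<and> Y \<subseteq> A \<and> x \<in> generate G Y"
  using assms
proof induction
  case one
  then show ?case using generate.one by blast
next
  case (incl h)
  then show ?case using generate.incl[of h "{h}" G] by blast
next
  case (inv h)
  then show ?case using generate.inv[of h "{h}" G] by blast
next
  case (eng h1 h2)
  then obtain Y Z where "finite Y" "Y \<subseteq> A" "h1 \<in> generate G Y" "finite Z" "Z \<subseteq> A" "h2 \<in> generate G Z"
    by blast
  then show ?case
    using mono_generate[of Y "Y \<union> Z"] mono_generate[of Z "Y \<union> Z"]
    by (intro exI[of _ "Y \<union> Z"]) (auto intro!: generate.eng)
qed

text \<open>Any generating set of a finitely generated subgroup contains a finite one. This extracts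
  finitely many conjugates from infinite families of conjugates.\<close>

lemma fg_subgroup_finite_subset:
  assumes "A \<subseteq> carrier G" "fg_subgroup G (generate G A)"
  shows "\<exists>Y. finite Y \<and> Y \<subseteq> A \<and> generate G Y = generate G A"
proof -
  obtain S where S: "finite S" "S \<subseteq> carrier G" "generate G S = generate G A"
    using assms(2) by (auto simp: fg_subgroup_def)
  have "\<forall>s\<in>S. \<exists>Y. finite Y \<and> Y \<subseteq> A \<and> s \<in> generate G Y"
    using S(3) generate.incl[of _ S G] generate_finite_support by blast
  then obtain Y where Y: "\<And>s. s \<in> S \<Longrightarrow> finite (Y s) \<and> Y s \<subseteq> A \<and> s \<in> generate G (Y s)" by metis
  let ?Y = "\<Union>s\<in>S. Y s"
  have sub: "?Y \<subseteq> A" using Y by blast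
  have "S \<subseteq> generate G ?Y"
  proof
    fix s assume s: "s \<in> S"
    then show "s \<in> generate G ?Y" using Y[OF s] mono_generate[of "Y s" ?Y] by blast
  qed
  then have "generate G S \<subseteq> generate G ?Y"
    using generate_subgroup_incl generate_is_subgroup sub assms(1) by (meson order_trans)
  then have "generate G ?Y = generate G A" using S(3) mono_generate[OF sub] by auto
  moreover have "finite ?Y" using S(1) Y by blast
  ultimately show ?thesis using sub by blast
qed

text \<open>The maximal condition gives generators by maximising over the finitely generated subgroups of
  \<open>H\<close>. Conversely, finite generation lets Zorn's lemma apply: the union of a chain is a finitely
  generated subgroup, its finitely many generators lie in one member, and so the union is that member.\<close>

theorem noetherian_group_iff: "noetherian_group G \<longleftrightarrow> (\<forall>H. subgroup H G \<longrightarrow> fg_subgroup G H)"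
proof (intro iffI allI impI)
  fix H assume noeth: "noetherian_group G" and H: "subgroup H G"
  note Hc = subgroup.subset[OF H]
  let ?F = "{generate G S | S. finite S \<and> S \<subseteq> H}"
  have "?F \<noteq> {}" by blast
  moreover have "\<forall>K\<in>?F. subgroup K G" using Hc generate_is_subgroup by blast
  ultimately obtain M where M: "M \<in> ?F" "\<forall>K\<in>?F. M \<subseteq> K \<longrightarrow> K = M"
    using noeth unfolding noetherian_group_def by meson
  then obtain S where S: "finite S" "S \<subseteq> H" "M = generate G S" by blast
  have "H \<subseteq> M"
  proof
    fix x assume x: "x \<in> H"
    have "generate G (insert x S) \<in> ?F" using S x by blast
    then have "generate G (insert x S) = M" using M(2) S(3) mono_generate[of S "insert x S"] by blast
    then show "x \<in> M" using generate.incl[of x "insert x S" G] by blast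
  qed
  then have "generate G S = H" using S generate_subgroup_incl[OF S(2) H] by blast
  then show "fg_subgroup G H" using S Hc unfolding fg_subgroup_def by blast
next
  assume fg: "\<forall>H. subgroup H G \<longrightarrow> fg_subgroup G H"
  show "noetherian_group G"
    unfolding noetherian_group_def
  proof (intro allI impI, elim conjE)
    fix \<S> :: "'a set set" assume ne: "\<S> \<noteq> {}" and sub: "\<forall>H\<in>\<S>. subgroup H G"
    show "\<exists>M\<in>\<S>. \<forall>H\<in>\<S>. M \<subseteq> H \<longrightarrow> H = M"
    proof (rule subset_Zorn_nonempty[OF ne])
      fix C assume C: "C \<noteq> {}" "subset.chain \<S> C"
      then have Csub: "C \<subseteq> \<S>" and total: "\<And>A B. A \<in> C \<Longrightarrow> B \<in> C \<Longrightarrow> A \<subseteq> B \<or> B \<subseteq> A"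
        by (auto simp: subset_chain_def)
      have Csub': "subgroup A G" if "A \<in> C" for A using that Csub sub by blast
      have "subgroup (\<Union>C) G"
      proof
        show "\<Union>C \<subseteq> carrier G" using Csub' subgroup.subset by (meson Union_least)
        show "\<one> \<in> \<Union>C" using C(1) Csub' subgroup.one_closed by auto
        show "inv x \<in> \<Union>C" if "x \<in> \<Union>C" for x
          using that Csub' subgroup.m_inv_closed by (meson UnionE UnionI)
        show "x \<otimes> y \<in> \<Union>C" if "x \<in> \<Union>C" "y \<in> \<Union>C" for x y
        proof -
          obtain A B where "A \<in> C" "x \<in> A" "B \<in> C" "y \<in> B" using \<open>x \<in> \<Union>C\<close> \<open>y \<in> \<Union>C\<close> by blast
          then obtain D where "D \<in> C" "x \<in> D" "y \<in> D" using total by blast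
          then show ?thesis using subgroup.m_closed[OF Csub'] by blast
        qed
      qed
      then obtain S where S: "finite S" "generate G S = \<Union>C"
        using fg unfolding fg_subgroup_def by blast
      have "S \<subseteq> \<Union>C" using S(2) generate.incl[of _ S G] by auto
      then obtain D where D: "D \<in> C" "S \<subseteq> D"
        using finite_subset_Union_chain[OF S(1) _ C] by blast
      have "\<Union>C \<subseteq> D" using generate_subgroup_incl[OF D(2) Csub'[OF D(1)]] S(2) by simp
      then have "\<Union>C = D" using D(1) by blast
      then show "\<Union>C \<in> \<S>" using D(1) Csub by blast
    qed
  qed
qed

end

lemma (in group_hom) fg_subgroup_img:
  assumes "fg_subgroup G K"
  shows "fg_subgroup H (h ` K)"
proof -
  obtain S where S: "finite S" "S \<subseteq> carrier G" "generate G S = K"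
    using assms by (auto simp: fg_subgroup_def)
  then have "generate H (h ` S) = h ` K" using generate_img by simp
  moreover have "h ` S \<subseteq> carrier H" using S(2) by auto
  ultimately show ?thesis using S(1) unfolding fg_subgroup_def by blast
qed

text \<open>Lifts of generators of the image, together with generators of the part in the kernel, generate:
  an element of \<open>K\<close> differs from a word in the lifts by an element of the kernel.\<close>

lemma (in group_hom) fg_subgroup_extension:
  assumes K: "subgroup K G"
    and img: "fg_subgroup H (h ` K)" and ker: "fg_subgroup G (K \<inter> kernel G H h)"
  shows "fg_subgroup G K"
proof -
  note Kc = subgroup.subset[OF K]
  obtain S where S: "finite S" "S \<subseteq> carrier H" "generate H S = h ` K"
    using img by (auto simp: fg_subgroup_def)
  obtain T where T: "finite T" "T \<subseteq> carrier G" "generate G T = K \<inter> kernel G H h"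
    using ker by (auto simp: fg_subgroup_def)
  have "S \<subseteq> h ` K" using S(3) generate.incl[of _ S H] by auto
  then obtain S' where S': "S' \<subseteq> K" "finite S'" "S = h ` S'"
    using S(1) by (meson finite_subset_image)
  have TK: "T \<subseteq> K" using T(3) generate.incl[of _ T G] by auto
  let ?M = "generate G (S' \<union> T)"
  have M: "subgroup ?M G" using S'(1) TK Kc by (intro G.generate_is_subgroup) auto
  have "K \<subseteq> ?M"
  proof
    fix x assume x: "x \<in> K"
    then have "h x \<in> h ` generate G S'" using S(3) S' generate_img[of S'] Kc by auto
    then obtain y where y: "y \<in> generate G S'" "h x = h y" by auto
    have yM: "y \<in> ?M" using y(1) G.mono_generate[of S' "S' \<union> T"] by auto
    have yK: "y \<in> K" using y(1) G.generate_subgroup_incl[OF S'(1) K] by auto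
    have xy: "inv y \<otimes> x \<in> K" using x yK K subgroup.m_closed subgroup.m_inv_closed by metis
    have "h (inv y \<otimes> x) = \<one>\<^bsub>H\<^esub>" using x yK Kc y(2) by (simp add: subset_iff)
    then have "inv y \<otimes> x \<in> generate G T" using xy Kc T(3) by (auto simp: kernel_def)
    then have "inv y \<otimes> x \<in> ?M" using G.mono_generate[of T "S' \<union> T"] by auto
    then have "y \<otimes> (inv y \<otimes> x) \<in> ?M" using yM M subgroup.m_closed by metis
    moreover have "y \<otimes> (inv y \<otimes> x) = x" using x yK Kc by (simp add: subset_iff G.m_assoc[symmetric])
    ultimately show "x \<in> ?M" by simp
  qed
  moreover have "?M \<subseteq> K" using S'(1) TK K by (intro G.generate_subgroup_incl) auto
  ultimately show ?thesis
    using S'(1,2) T(1) TK Kc unfolding fg_subgroup_def by (intro exI[of _ "S' \<union> T"]) auto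
qed

section \<open>Subgroups of finitely generated abelian groups\<close>

text \<open>The least positive exponent \<open>d\<close> with \<open>s [^] d \<in> K\<close> gives a generator, by division with remainder;
  if there is none, \<open>K\<close> is trivial.\<close>

lemma (in group) fg_subgroup_of_cyclic:
  assumes s: "s \<in> carrier G" and K: "subgroup K G" "K \<subseteq> generate G {s}"
  shows "fg_subgroup G K"
proof (cases "\<exists>d::nat. d > 0 \<and> s [^] int d \<in> K")
  case True
  define d where "d = (LEAST d::nat. d > 0 \<and> s [^] int d \<in> K)"
  have d: "d > 0" "s [^] int d \<in> K" using LeastI_ex[OF True] by (simp_all add: d_def)
  have "K \<subseteq> generate G {s [^] int d}"
  proof
    fix x assume x: "x \<in> K"
    then obtain k :: int where k: "x = s [^] k" using K(2) generate_pow[OF s] by blast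
    define r where "r = nat (k mod int d)"
    have r: "int r = k mod int d" using d(1) by (simp add: r_def)
    have "x = (s [^] int d) [^] (k div int d) \<otimes> s [^] int r"
      using s by (simp add: k r int_pow_pow int_pow_mult[symmetric])
    moreover have dd: "(s [^] int d) [^] (k div int d) \<in> K"
      by (rule subgroup_int_pow_closed[OF K(1) d(2)])
    ultimately have "s [^] int r = inv ((s [^] int d) [^] (k div int d)) \<otimes> x"
      using s by (simp add: inv_solve_left)
    then have "s [^] int r \<in> K" using dd x K(1) subgroup.m_closed subgroup.m_inv_closed by metis
    moreover have "r < d" using d(1) r pos_mod_bound[of "int d" k] by linarith
    ultimately have "r = 0" using not_less_Least[of r] unfolding d_def[symmetric]
      by (metis (mono_tags, lifting) d_def gr0I not_less_Least)
    then have "x = (s [^] int d) [^] (k div int d)"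
      using s \<open>x = (s [^] int d) [^] (k div int d) \<otimes> s [^] int r\<close> by simp
    then show "x \<in> generate G {s [^] int d}" using generate_pow[of "s [^] int d"] s by auto
  qed
  moreover have "generate G {s [^] int d} \<subseteq> K" using d(2) K(1) by (intro generate_subgroup_incl) auto
  ultimately have "generate G {s [^] int d} = K" by blast
  then show ?thesis using fg_subgroup_generate_finite[of "{s [^] int d}"] s by auto
next
  case False
  have "x = \<one>" if x: "x \<in> K" for x
  proof -
    obtain k :: int where k: "x = s [^] k" using x K(2) generate_pow[OF s] by blast
    have "\<not> k > 0" using False x k by (metis zero_less_imp_eq_int)
    moreover have "\<not> k < 0"
    proof
      assume "k < 0"
      have "s [^] (- k) \<in> K" using subgroup.m_inv_closed[OF K(1) x] k s by (simp add: int_pow_neg)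
      then show False using False \<open>k < 0\<close> by (metis neg_0_less_iff_less zero_less_imp_eq_int)
    qed
    ultimately have "k = 0" by simp
    then show ?thesis using k by simp
  qed
  then have "K = {\<one>}" using subgroup.one_closed[OF K(1)] by blast
  then have "K = generate G {}" by (simp add: generate_empty)
  then show ?thesis using fg_subgroup_generate_finite[of "{}"] by simp
qed

lemma (in normal) group_hom_r_coset: "group_hom G (G Mod H) (\<lambda>a. H #> a)"
  using r_coset_hom_Mod factorgroup_is_group is_group
  by (intro group_hom.intro group_hom_axioms.intro)

lemma (in group) r_coset_img_generate_Un:
  assumes N: "N \<lhd> G" and A: "A \<subseteq> carrier G" "B \<subseteq> N"
  shows "(\<lambda>a. N #> a) ` generate G (A \<union> B) = (\<lambda>a. N #> a) ` generate G A"
proof -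
  interpret N: normal N G by fact
  interpret q: group_hom G "G Mod N" "\<lambda>a. N #> a"
    by (rule N.group_hom_r_coset)
  have Bc: "B \<subseteq> carrier G" using A(2) N.subset by blast
  have "(\<lambda>a. N #> a) ` (A \<union> B) \<subseteq> generate (G Mod N) ((\<lambda>a. N #> a) ` A)"
  proof
    fix y assume "y \<in> (\<lambda>a. N #> a) ` (A \<union> B)"
    then obtain x where x: "x \<in> A \<union> B" "y = N #> x" by blast
    show "y \<in> generate (G Mod N) ((\<lambda>a. N #> a) ` A)"
    proof (cases "x \<in> A")
      case True then show ?thesis using x by (auto intro: generate.incl)
    next
      case False
      then have "y = \<one>\<^bsub>G Mod N\<^esub>" using x A(2) by (simp add: N.rcos_const subset_iff)
      then show ?thesis using generate.one by metis
    qed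
  qed
  moreover have "(\<lambda>a. N #> a) ` A \<subseteq> carrier (G Mod N)" using A(1) q.hom_closed by blast
  ultimately have "generate (G Mod N) ((\<lambda>a. N #> a) ` (A \<union> B)) \<subseteq> generate (G Mod N) ((\<lambda>a. N #> a) ` A)"
    using q.H.generate_subgroup_incl q.H.generate_is_subgroup by metis
  then have "(\<lambda>a. N #> a) ` generate G (A \<union> B) \<subseteq> (\<lambda>a. N #> a) ` generate G A"
    using q.generate_img[of "A \<union> B"] q.generate_img[of A] A(1) Bc by auto
  moreover have "generate G A \<subseteq> generate G (A \<union> B)" by (rule mono_generate) simp
  ultimately show ?thesis by blast
qed

lemma (in group) kernel_r_coset:
  assumes "N \<lhd> G"
  shows "kernel G (G Mod N) (\<lambda>a. N #> a) = N"
proof -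
  interpret normal N G by fact
  show ?thesis
    using rcos_const rcos_self[OF _ is_subgroup] subset
    by (auto simp: kernel_def)
qed

text \<open>Induction on the number of generators: modulo the subgroup generated by all but one of them, the
  group is cyclic.\<close>

lemma (in comm_group) fg_subgroup_of_finitely_generated:
  assumes "finite S" "S \<subseteq> carrier G" "subgroup K G" "K \<subseteq> generate G S"
  shows "fg_subgroup G K"
  using assms
proof (induction S arbitrary: K)
  case empty
  then have "K = generate G {}"
    using generate_empty subgroup.one_closed by fastforce
  then show ?case using fg_subgroup_generate_finite[of "{}"] by simp
next
  case (insert s S)
  let ?N = "generate G S"
  have s: "s \<in> carrier G" and S: "S \<subseteq> carrier G" using insert.prems by auto
  have N: "?N \<lhd> G" using generate_is_subgroup[OF S] by (rule subgroup_imp_normal)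
  interpret N: normal ?N G by (rule N)
  interpret q: group_hom G "G Mod ?N" "\<lambda>a. ?N #> a"
    by (rule N.group_hom_r_coset)
  show ?case
  proof (rule q.fg_subgroup_extension[OF insert.prems(2)])
    have "(\<lambda>a. ?N #> a) ` generate G ({s} \<union> S) = (\<lambda>a. ?N #> a) ` generate G {s}"
      using s generate.incl[of _ S G] by (intro r_coset_img_generate_Un N) auto
    also have "\<dots> = generate (G Mod ?N) {?N #> s}"
      using q.generate_img[of "{s}"] s by simp
    finally have "(\<lambda>a. ?N #> a) ` K \<subseteq> generate (G Mod ?N) {?N #> s}"
      using insert.prems(3) by auto
    then show "fg_subgroup (G Mod ?N) ((\<lambda>a. ?N #> a) ` K)"
      using q.hom_closed[OF s] q.subgroup_img_is_subgroup[OF insert.prems(2)]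
      by (intro q.H.fg_subgroup_of_cyclic)
    have "subgroup (K \<inter> ?N) G"
      using insert.prems(2) N.is_subgroup by (rule subgroups_Inter_pair)
    then show "fg_subgroup G (K \<inter> kernel G (G Mod ?N) (\<lambda>a. ?N #> a))"
      unfolding kernel_r_coset[OF N] using insert.IH S by blast
  qed
qed

text \<open>Centralisers are subgroups; they are taken twice, first of the generators and then of everything
  that the generators generate.\<close>

lemma (in group) generate_commute:
  assumes S: "S \<subseteq> carrier G" and comm: "\<And>a b. a \<in> S \<Longrightarrow> b \<in> S \<Longrightarrow> a \<otimes> b = b \<otimes> a"
    and x: "x \<in> generate G S" and y: "y \<in> generate G S"
  shows "x \<otimes> y = y \<otimes> x"
proof -
  let ?C = "\<lambda>A. {z \<in> carrier G. \<forall>a\<in>A. z \<otimes> a = a \<otimes> z}"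
  have C: "subgroup (?C A) G" if A: "A \<subseteq> carrier G" for A
  proof
    fix u v assume u: "u \<in> ?C A" and v: "v \<in> ?C A"
    have "u \<otimes> v \<otimes> a = a \<otimes> (u \<otimes> v)" if a: "a \<in> A" for a
    proof -
      have ac: "a \<in> carrier G" using a A by blast
      have "u \<otimes> v \<otimes> a = u \<otimes> (v \<otimes> a)" using u v ac by (simp add: m_assoc)
      also have "v \<otimes> a = a \<otimes> v" using v a by blast
      also have "u \<otimes> (a \<otimes> v) = (u \<otimes> a) \<otimes> v" using u v ac by (simp add: m_assoc)
      also have "u \<otimes> a = a \<otimes> u" using u a by blast
      also have "a \<otimes> u \<otimes> v = a \<otimes> (u \<otimes> v)" using u v ac by (simp add: m_assoc)
      finally show ?thesis .
    qed
    then show "u \<otimes> v \<in> ?C A" using u v by simp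
  next
    fix u assume u: "u \<in> ?C A"
    have "inv u \<otimes> a = a \<otimes> inv u" if a: "a \<in> A" for a
    proof -
      have ac: "a \<in> carrier G" using a A by blast
      have "a = inv u \<otimes> (u \<otimes> a)" using u ac by (simp add: m_assoc[symmetric])
      also have "u \<otimes> a = a \<otimes> u" using u a by blast
      finally have "a \<otimes> inv u = inv u \<otimes> (a \<otimes> u) \<otimes> inv u" by simp
      then show ?thesis using u ac by (simp add: m_assoc)
    qed
    then show "inv u \<in> ?C A" using u by simp
  qed (use A in auto)
  have "generate G S \<subseteq> ?C S"
    using S comm by (intro generate_subgroup_incl C) auto
  then have "S \<subseteq> ?C (generate G S)"
    using S by fastforce
  then have "generate G S \<subseteq> ?C (generate G S)"
    by (rule generate_subgroup_incl[OF _ C[OF generate_incl[OF S]]])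
  then show ?thesis using x y by blast
qed

text \<open>The factors of the derived series of \<open>G\<close> are commutative subgroups of quotients that need not be
  commutative themselves, hence this version for a commutative subgroup of an arbitrary group.\<close>

lemma (in group) fg_subgroup_of_fg_commutative:
  assumes A: "fg_subgroup G A" "\<And>x y. x \<in> A \<Longrightarrow> y \<in> A \<Longrightarrow> x \<otimes> y = y \<otimes> x"
    and K: "subgroup K G" "K \<subseteq> A"
  shows "fg_subgroup G K"
proof -
  obtain S where S: "finite S" "S \<subseteq> carrier G" "generate G S = A"
    using A(1) by (auto simp: fg_subgroup_def)
  have SA: "S \<subseteq> A" using S(3) generate.incl[of _ S G] by auto
  have Asub: "subgroup A G" using S(2,3) generate_is_subgroup by auto
  interpret A: group "G\<lparr>carrier := A\<rparr>" by (rule subgroup_imp_group[OF Asub])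
  interpret A: comm_group "G\<lparr>carrier := A\<rparr>"
    by (rule A.group_comm_groupI) (use A(2) in auto)
  have "fg_subgroup (G\<lparr>carrier := A\<rparr>) K"
    using S SA K Asub
    by (intro A.fg_subgroup_of_finitely_generated[of S])
      (auto simp: generate_consistent subgroup_incl)
  then obtain T where T: "finite T" "T \<subseteq> A" "generate (G\<lparr>carrier := A\<rparr>) T = K"
    by (auto simp: fg_subgroup_def)
  then show ?thesis
    using generate_consistent[OF T(2) Asub] subgroup.subset[OF Asub]
    unfolding fg_subgroup_def by blast
qed

section \<open>Normal closures and the derived series\<close>

definition normal_closure :: "('a, 'b) monoid_scheme \<Rightarrow> 'a set \<Rightarrow> 'a set" where
  "normal_closure G A = generate G (\<Union>g\<in>carrier G. (\<lambda>a. g \<otimes>\<^bsub>G\<^esub> a \<otimes>\<^bsub>G\<^esub> inv\<^bsub>G\<^esub> g) ` A)"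

context group
begin

lemma conjugates_subset:
  "A \<subseteq> carrier G \<Longrightarrow> (\<Union>g\<in>carrier G. (\<lambda>a. g \<otimes> a \<otimes> inv g) ` A) \<subseteq> carrier G"
  by auto

lemma normal_closure_normal:
  assumes "A \<subseteq> carrier G" shows "normal_closure G A \<lhd> G"
  unfolding normal_closure_def
proof (rule normal_generateI[OF conjugates_subset[OF assms]])
  fix h g assume h: "h \<in> (\<Union>g\<in>carrier G. (\<lambda>a. g \<otimes> a \<otimes> inv g) ` A)" and g: "g \<in> carrier G"
  then obtain k a where ka: "k \<in> carrier G" "a \<in> A" "h = k \<otimes> a \<otimes> inv k" by blast
  then have "g \<otimes> h \<otimes> inv g = (g \<otimes> k) \<otimes> a \<otimes> inv (g \<otimes> k)"
    using g assms by (simp add: subset_iff inv_mult_group m_assoc)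
  then show "g \<otimes> h \<otimes> inv g \<in> (\<Union>g\<in>carrier G. (\<lambda>a. g \<otimes> a \<otimes> inv g) ` A)"
    using ka g by blast
qed

lemma normal_closure_minimal:
  assumes "N \<lhd> G" "A \<subseteq> N" shows "normal_closure G A \<subseteq> N"
  unfolding normal_closure_def
proof (rule generate_subgroup_incl[OF _ normal_imp_subgroup[OF assms(1)]])
  show "(\<Union>g\<in>carrier G. (\<lambda>a. g \<otimes> a \<otimes> inv g) ` A) \<subseteq> N"
    using normal.inv_op_closed2[OF assms(1)] assms(2) by (auto simp: subset_iff)
qed

lemma subset_normal_closure:
  assumes "A \<subseteq> carrier G" shows "A \<subseteq> normal_closure G A"
proof
  fix a assume a: "a \<in> A"
  then have "a = \<one> \<otimes> a \<otimes> inv \<one>" using assms by auto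
  then show "a \<in> normal_closure G A"
    using a unfolding normal_closure_def by (intro generate.incl) blast
qed

lemma normal_closure_eq_generate_Union:
  assumes "A \<subseteq> carrier G"
  shows "normal_closure G A = generate G (\<Union>a\<in>A. \<Union>g\<in>carrier G. {g \<otimes> a \<otimes> inv g})"
  unfolding normal_closure_def by (rule arg_cong[where f = "generate G"]) blast

lemma fg_subgroup_normal_closure_finite:
  assumes "finite A" "A \<subseteq> carrier G" "\<And>a. a \<in> A \<Longrightarrow> fg_subgroup G (normal_closure G {a})"
  shows "fg_subgroup G (normal_closure G A)"
  unfolding normal_closure_eq_generate_Union[OF assms(2)]
proof (rule fg_subgroup_generate_Union[OF assms(1)])
  fix a assume a: "a \<in> A"
  show "(\<Union>g\<in>carrier G. {g \<otimes> a \<otimes> inv g}) \<subseteq> carrier G" using a assms(2) by auto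
  show "fg_subgroup G (generate G (\<Union>g\<in>carrier G. {g \<otimes> a \<otimes> inv g}))"
    using assms(3)[OF a] by (simp add: normal_closure_def)
qed

lemma r_coset_eq_iff:
  assumes "N \<lhd> G" "a \<in> carrier G" "b \<in> carrier G"
  shows "N #> a = N #> b \<longleftrightarrow> a \<otimes> inv b \<in> N"
proof -
  interpret normal N G by fact
  have "N #> a = N #> b \<longleftrightarrow> a \<in> N #> b"
    using rcos_self[OF assms(2) is_subgroup] repr_independence[OF _ assms(3) is_subgroup] by blast
  then show ?thesis using rcos_module[OF is_group assms(3,2)] by simp
qed

lemma commutator_conv:
  assumes "a \<in> carrier G" "b \<in> carrier G"
  shows "a \<otimes> b \<otimes> inv a \<otimes> inv b = (a \<otimes> b) \<otimes> inv (b \<otimes> a)"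
  using assms by (simp add: inv_mult_group m_assoc)

text \<open>Modulo the normal closure of the commutators of the generators, the generators commute, and
  hence so does all of \<open>H\<close>. For finite \<open>S\<close> this describes \<open>derived G H\<close> by finitely many elements,
  although as a group it may need infinitely many generators.\<close>

lemma derived_generate_eq_normal_closure:
  assumes S: "S \<subseteq> carrier G" and H: "H \<lhd> G" "H = generate G S"
  shows "derived G H = normal_closure G {a \<otimes> b \<otimes> inv a \<otimes> inv b | a b. a \<in> S \<and> b \<in> S}"
    (is "_ = normal_closure G ?A")
proof
  have A: "?A \<subseteq> carrier G" using S by auto
  have SH: "S \<subseteq> H" using generate.incl[of _ S G] H(2) by blast
  have "?A \<subseteq> derived_set G H" using SH by blast
  then have "?A \<subseteq> derived G H" unfolding derived_def using generate.incl[of _ "derived_set G H" G] by blast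
  then show "normal_closure G ?A \<subseteq> derived G H"
    by (intro normal_closure_minimal derived_is_normal H(1))
  let ?N = "normal_closure G ?A"
  have N: "?N \<lhd> G" by (rule normal_closure_normal[OF A])
  interpret N: normal ?N G by (rule N)
  interpret q: group_hom G "G Mod ?N" "\<lambda>a. ?N #> a" by (rule N.group_hom_r_coset)
  have Hc: "H \<subseteq> carrier G" using H(2) generate_incl[OF S] by simp
  have comm: "u \<otimes>\<^bsub>G Mod ?N\<^esub> v = v \<otimes>\<^bsub>G Mod ?N\<^esub> u"
    if "u \<in> (\<lambda>a. ?N #> a) ` S" "v \<in> (\<lambda>a. ?N #> a) ` S" for u v
  proof -
    obtain a b where ab: "a \<in> S" "b \<in> S" "u = ?N #> a" "v = ?N #> b" using \<open>u \<in> _\<close> \<open>v \<in> _\<close> by blast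
    have abc: "a \<in> carrier G" "b \<in> carrier G" using ab S by auto
    have "a \<otimes> b \<otimes> inv a \<otimes> inv b \<in> ?N" using ab(1,2) subset_normal_closure[OF A] by blast
    then have "?N #> (a \<otimes> b) = ?N #> (b \<otimes> a)"
      using abc r_coset_eq_iff[OF N, of "a \<otimes> b" "b \<otimes> a"] commutator_conv[OF abc] by simp
    then show ?thesis using q.hom_mult[OF abc] q.hom_mult[OF abc(2,1)] ab(3,4) by simp
  qed
  have qS: "(\<lambda>a. ?N #> a) ` S \<subseteq> carrier (G Mod ?N)" using S q.hom_closed by blast
  have "derived_set G H \<subseteq> ?N"
  proof
    fix z assume "z \<in> derived_set G H"
    then obtain x y where xy: "x \<in> H" "y \<in> H" "z = x \<otimes> y \<otimes> inv x \<otimes> inv y" by blast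
    have xyc: "x \<in> carrier G" "y \<in> carrier G" using xy Hc by auto
    have "?N #> x \<in> generate (G Mod ?N) ((\<lambda>a. ?N #> a) ` S)"
      "?N #> y \<in> generate (G Mod ?N) ((\<lambda>a. ?N #> a) ` S)"
      using xy(1,2) H(2) q.generate_img[OF S] by auto
    then have "?N #> (x \<otimes> y) = ?N #> (y \<otimes> x)"
      using q.H.generate_commute[OF qS comm, of "?N #> x" "?N #> y"]
        q.hom_mult[OF xyc] q.hom_mult[OF xyc(2,1)] by simp
    then show "z \<in> ?N"
      using xyc r_coset_eq_iff[OF N, of "x \<otimes> y" "y \<otimes> x"] commutator_conv[OF xyc] xy(3) by simp
  qed
  then show "derived G H \<subseteq> ?N"
    unfolding derived_def by (rule generate_subgroup_incl[OF _ N.is_subgroup])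
qed

lemma derived_series_normal: "(derived G ^^ k) (carrier G) \<lhd> G"
  by (induction k) (simp_all add: normal_self derived_is_normal)

lemma fg_subgroup_derived_series:
  assumes "fg_subgroup G (carrier G)" "\<And>s. s \<in> carrier G \<Longrightarrow> fg_subgroup G (normal_closure G {s})"
  shows "fg_subgroup G ((derived G ^^ k) (carrier G))"
proof (induction k)
  case 0
  then show ?case using assms(1) by simp
next
  case (Suc k)
  let ?H = "(derived G ^^ k) (carrier G)"
  obtain S where S: "finite S" "S \<subseteq> carrier G" "generate G S = ?H"
    using Suc by (auto simp: fg_subgroup_def)
  let ?A = "{a \<otimes> b \<otimes> inv a \<otimes> inv b | a b. a \<in> S \<and> b \<in> S}"
  have "?A = (\<lambda>(a, b). a \<otimes> b \<otimes> inv a \<otimes> inv b) ` (S \<times> S)" by auto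
  then have fin: "finite ?A" using S(1) by simp
  have sub: "?A \<subseteq> carrier G" using S(2) by auto
  have "fg_subgroup G (normal_closure G ?A)"
    by (rule fg_subgroup_normal_closure_finite[OF fin sub assms(2)[OF subsetD[OF sub]]])
  then show ?case
    using derived_generate_eq_normal_closure[OF S(2) derived_series_normal S(3)[symmetric]] by simp
qed

text \<open>Climbing the derived series from its trivial end, a subgroup of one term is an extension of a
  subgroup of the next term by a subgroup of a finitely generated abelian factor.\<close>

lemma noetherian_group_if_derived_series_fg:
  assumes "solvable G" "\<And>k. fg_subgroup G ((derived G ^^ k) (carrier G))"
  shows "noetherian_group G"
proof -
  obtain d where d: "(derived G ^^ d) (carrier G) = {\<one>}"
    using assms(1) solvable_iff_trivial_derived_seq by blast
  have "fg_subgroup G K" if "k \<le> d" "subgroup K G" "K \<subseteq> (derived G ^^ k) (carrier G)" for k K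
    using that
  proof (induction k arbitrary: K rule: inc_induct)
    case base
    then have "K = generate G {}" using d generate_empty subgroup.one_closed by fastforce
    then show ?case using fg_subgroup_generate_finite[of "{}"] by simp
  next
    case (step k)
    let ?D = "(derived G ^^ k) (carrier G)" and ?N = "(derived G ^^ Suc k) (carrier G)"
    have N: "?N \<lhd> G" by (rule derived_series_normal)
    interpret N: normal ?N G by (rule N)
    interpret q: group_hom G "G Mod ?N" "\<lambda>a. ?N #> a" by (rule N.group_hom_r_coset)
    have Dc: "?D \<subseteq> carrier G" by (simp add: exp_of_derived_in_carrier)
    show ?case
    proof (rule q.fg_subgroup_extension[OF step.prems(1)])
      show "fg_subgroup (G Mod ?N) ((\<lambda>a. ?N #> a) ` K)"
      proof (rule q.H.fg_subgroup_of_fg_commutative)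
        show "fg_subgroup (G Mod ?N) ((\<lambda>a. ?N #> a) ` ?D)"
          by (rule q.fg_subgroup_img[OF assms(2)])
        show "subgroup ((\<lambda>a. ?N #> a) ` K) (G Mod ?N)"
          by (rule q.subgroup_img_is_subgroup[OF step.prems(1)])
        show "(\<lambda>a. ?N #> a) ` K \<subseteq> (\<lambda>a. ?N #> a) ` ?D" using step.prems(2) by blast
        fix u v assume "u \<in> (\<lambda>a. ?N #> a) ` ?D" "v \<in> (\<lambda>a. ?N #> a) ` ?D"
        then obtain a b where ab: "a \<in> ?D" "b \<in> ?D" "u = ?N #> a" "v = ?N #> b" by blast
        have abc: "a \<in> carrier G" "b \<in> carrier G" using ab Dc by auto
        have "a \<otimes> b \<otimes> inv a \<otimes> inv b \<in> ?N"
          using ab(1,2) generate.incl[of _ "derived_set G ?D" G] by (auto simp: derived_def)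
        then have "?N #> (a \<otimes> b) = ?N #> (b \<otimes> a)"
          using abc r_coset_eq_iff[OF N, of "a \<otimes> b" "b \<otimes> a"] commutator_conv[OF abc] by simp
        then show "u \<otimes>\<^bsub>G Mod ?N\<^esub> v = v \<otimes>\<^bsub>G Mod ?N\<^esub> u"
          using q.hom_mult[OF abc] q.hom_mult[OF abc(2,1)] ab(3,4) by simp
      qed
      have "subgroup (K \<inter> ?N) G"
        using step.prems(1) N.is_subgroup by (rule subgroups_Inter_pair)
      then show "fg_subgroup G (K \<inter> kernel G (G Mod ?N) (\<lambda>a. ?N #> a))"
        unfolding kernel_r_coset[OF N] using step.IH by blast
    qed
  qed
  from this[of 0] show ?thesis
    unfolding noetherian_group_iff using subgroup.subset by auto
qed

text \<open>A product of two soluble normal subgroups is soluble: modulo the second factor it is an image of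
  the first.\<close>

lemma solvable_seq_normal_closure_finite:
  assumes "finite S" "S \<subseteq> carrier G" "\<And>s. s \<in> S \<Longrightarrow> solvable_seq G (normal_closure G {s})"
  shows "solvable_seq G (normal_closure G S)"
  using assms
proof (induction S)
  case empty
  then show ?case by (simp add: normal_closure_def generate_empty solvable_seq.unity)
next
  case (insert s S)
  let ?N = "normal_closure G S" and ?J = "normal_closure G (insert s S)"
  have s: "s \<in> carrier G" and S: "S \<subseteq> carrier G" using insert.prems by auto
  have N: "?N \<lhd> G" by (rule normal_closure_normal[OF S])
  interpret N: normal ?N G by (rule N)
  interpret q: group_hom G "G Mod ?N" "\<lambda>a. ?N #> a" by (rule N.group_hom_r_coset)
  let ?c = "\<lambda>A. \<Union>g\<in>carrier G. (\<lambda>a. g \<otimes> a \<otimes> inv g) ` A"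
  have "?c S \<subseteq> ?N" unfolding normal_closure_def using generate.incl[of _ "?c S" G] by blast
  then have "(\<lambda>a. ?N #> a) ` generate G (?c {s} \<union> ?c S) = (\<lambda>a. ?N #> a) ` generate G (?c {s})"
    using conjugates_subset[of "{s}"] s by (intro r_coset_img_generate_Un N) auto
  moreover have "?c {s} \<union> ?c S = ?c (insert s S)" by blast
  ultimately have img: "(\<lambda>a. ?N #> a) ` ?J = (\<lambda>a. ?N #> a) ` normal_closure G {s}"
    by (simp only: normal_closure_def)
  have "group_hom G G id"
    using is_group by (intro group_hom.intro group_hom_axioms.intro) (auto simp: hom_def)
  then show ?case
  proof (rule solvable_seq_condition[OF _ q.group_hom_axioms, where f = id and I = ?N])
    show "id ` ?N \<subseteq> ?J" 
      unfolding normal_closure_def by (simp, intro mono_generate) blast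
    show "kernel G (G Mod ?N) (\<lambda>a. ?N #> a) \<subseteq> id ` ?N" using kernel_r_coset[OF N] by simp
    show "subgroup ?J G" using insert.prems(1) by (intro normal_imp_subgroup normal_closure_normal)
    show "solvable_seq G ?N" using insert.IH insert.prems S by blast
    show "solvable_seq (G Mod ?N) ((\<lambda>a. ?N #> a) ` ?J)"
      unfolding img by (intro q.solvable_imp_solvable_img insert.prems) simp
  qed
qed

text \<open>A finitely generated group is the normal closure of finitely many elements, which yields
  solubility; finite generation of normal closures then passes down the derived series.\<close>

theorem polycyclic_groupI:
  assumes fg: "finitely_generated_group G"
    and cl: "\<And>s. s \<in> carrier G \<Longrightarrow> fg_subgroup G (normal_closure G {s})"
      "\<And>s. s \<in> carrier G \<Longrightarrow> solvable_seq G (normal_closure G {s})"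
  shows "polycyclic_group G"
proof -
  obtain S where S: "finite S" "S \<subseteq> carrier G" "generate G S = carrier G"
    using fg by (auto simp: finitely_generated_group_def)
  have "carrier G \<subseteq> normal_closure G S"
    using generate_subgroup_incl[OF subset_normal_closure[OF S(2)]]
      normal_imp_subgroup[OF normal_closure_normal[OF S(2)]] S(3) by simp
  then have "normal_closure G S = carrier G"
    using subgroup.subset[OF normal_imp_subgroup[OF normal_closure_normal[OF S(2)]]] by blast
  then have solv: "solvable G"
    using solvable_seq_normal_closure_finite[OF S(1,2)] cl(2) S(2) unfolding solvable_def by auto
  then show ?thesis
    using noetherian_group_if_derived_series_fg[OF solv fg_subgroup_derived_series] fg cl(1)
    by (simp add: polycyclic_group_def finitely_generated_group_iff)
qed

end

section \<open>Conjugation of functions by constants\<close>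

abbreviation fun_group :: "('a, 'b) monoid_scheme \<Rightarrow> 'y set \<Rightarrow> ('y \<Rightarrow> 'a) monoid" where
  "fun_group G Y \<equiv> product_group Y (\<lambda>_. G)"

definition conj_fun :: "('a, 'b) monoid_scheme \<Rightarrow> 'y set \<Rightarrow> 'a \<Rightarrow> ('y \<Rightarrow> 'a) \<Rightarrow> 'y \<Rightarrow> 'a" where
  "conj_fun G Y g f = (\<lambda>y\<in>Y. g \<otimes>\<^bsub>G\<^esub> f y \<otimes>\<^bsub>G\<^esub> inv\<^bsub>G\<^esub> g)"

text \<open>The orbit under conjugation by constant functions only, in general smaller than the
  conjugacy class of \<open>f\<close> in the function group.\<close>

definition conj_orbit :: "('a, 'b) monoid_scheme \<Rightarrow> 'y set \<Rightarrow> ('y \<Rightarrow> 'a) \<Rightarrow> ('y \<Rightarrow> 'a) set" where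
  "conj_orbit G Y f = (\<lambda>g. conj_fun G Y g f) ` carrier G"

lemma hom_eq_on_generate:
  assumes "group_hom G H h" "group_hom G H k" "S \<subseteq> carrier G"
    and eq: "\<And>s. s \<in> S \<Longrightarrow> h s = k s" and x: "x \<in> generate G S"
  shows "h x = k x"
proof -
  interpret h: group_hom G H h by fact
  interpret k: group_hom G H k by fact
  from x show ?thesis
  proof induction
    case (inv s)
    then show ?case using eq assms(3) by (simp add: subset_iff)
  next
    case (eng x y)
    then have "x \<in> carrier G" "y \<in> carrier G" using h.G.generate_in_carrier[OF assms(3)] by auto
    then show ?case using eng by simp
  qed (use eq in simp_all)
qed

context group
begin

lemma fg_subgroup_generate_Un:
  assumes "A \<subseteq> carrier G" "B \<subseteq> carrier G"
    and "fg_subgroup G (generate G A)" "fg_subgroup G (generate G B)"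
  shows "fg_subgroup G (generate G (A \<union> B))"
  using fg_subgroup_generate_Union[of "{A, B}" "\<lambda>x. x"] assms by auto

lemma group_fun_group: "group (fun_group G Y)"
  using is_group by simp

lemma group_hom_eval:
  assumes "y \<in> Y" shows "group_hom (fun_group G Y) G (\<lambda>f. f y)"
proof (intro group_hom.intro group_hom_axioms.intro group_fun_group is_group homI)
qed (use assms in auto)

lemma group_hom_precompose:
  assumes "f \<in> Z \<rightarrow> Y" shows "group_hom (fun_group G Y) (fun_group G Z) (\<lambda>u. \<lambda>z\<in>Z. u (f z))"
proof (intro group_hom.intro group_hom_axioms.intro group_fun_group homI)
qed (use assms in \<open>auto simp: Pi_iff PiE_iff fun_eq_iff\<close>)

lemma conj_fun_closed:
  assumes "g \<in> carrier G" "f \<in> carrier (fun_group G Y)"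
  shows "conj_fun G Y g f \<in> carrier (fun_group G Y)"
  using assms by (auto simp: conj_fun_def PiE_iff)

lemma conj_product:
  assumes "g \<in> carrier G" "a \<in> carrier G" "b \<in> carrier G"
  shows "g \<otimes> (a \<otimes> b) \<otimes> inv g = (g \<otimes> a \<otimes> inv g) \<otimes> (g \<otimes> b \<otimes> inv g)"
proof -
  have "(g \<otimes> a \<otimes> inv g) \<otimes> (g \<otimes> b \<otimes> inv g) = g \<otimes> a \<otimes> (inv g \<otimes> g) \<otimes> b \<otimes> inv g"
    using assms by (simp only: m_assoc m_closed inv_closed)
  then show ?thesis using assms by (simp add: m_assoc)
qed

lemma group_hom_conj_fun:
  assumes "g \<in> carrier G" shows "group_hom (fun_group G Y) (fun_group G Y) (conj_fun G Y g)"
proof (intro group_hom.intro group_hom_axioms.intro group_fun_group homI)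
  fix u v assume "u \<in> carrier (fun_group G Y)" "v \<in> carrier (fun_group G Y)"
  then show "conj_fun G Y g (u \<otimes>\<^bsub>fun_group G Y\<^esub> v)
      = conj_fun G Y g u \<otimes>\<^bsub>fun_group G Y\<^esub> conj_fun G Y g v"
    using assms by (auto simp: conj_fun_def PiE_iff fun_eq_iff conj_product)
qed (rule conj_fun_closed[OF assms])

lemma conj_fun_conj_fun:
  assumes "g \<in> carrier G" "h \<in> carrier G" "f \<in> carrier (fun_group G Y)"
  shows "conj_fun G Y g (conj_fun G Y h f) = conj_fun G Y (g \<otimes> h) f"
  using assms by (auto simp: conj_fun_def PiE_iff fun_eq_iff inv_mult_group m_assoc)

lemma conj_fun_one:
  assumes "f \<in> carrier (fun_group G Y)" shows "conj_fun G Y \<one> f = f"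
proof
  show "conj_fun G Y \<one> f y = f y" for y
    using assms by (cases "y \<in> Y") (auto simp: conj_fun_def PiE_iff extensional_def)
qed

lemma conj_orbit_subset:
  assumes "f \<in> carrier (fun_group G Y)" shows "conj_orbit G Y f \<subseteq> carrier (fun_group G Y)"
  unfolding conj_orbit_def using conj_fun_closed[OF _ assms] by blast

lemma self_in_conj_orbit:
  assumes "f \<in> carrier (fun_group G Y)" shows "f \<in> conj_orbit G Y f"
  using conj_fun_one[OF assms, symmetric] unfolding conj_orbit_def by (rule image_eqI) simp

lemma conj_fun_conj_orbit:
  assumes "g \<in> carrier G" "f \<in> carrier (fun_group G Y)" "u \<in> conj_orbit G Y f"
  shows "conj_fun G Y g u \<in> conj_orbit G Y f"
proof -
  obtain h where h: "h \<in> carrier G" "u = conj_fun G Y h f" using assms(3) by (auto simp: conj_orbit_def)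
  then have "conj_fun G Y g u = conj_fun G Y (g \<otimes> h) f" using conj_fun_conj_fun assms by simp
  then show ?thesis using h(1) assms(1) unfolding conj_orbit_def by simp
qed

lemma conj_fun_generate:
  assumes g: "g \<in> carrier G" and A: "A \<subseteq> carrier (fun_group G Y)"
    and gA: "\<And>a. a \<in> A \<Longrightarrow> conj_fun G Y g a \<in> generate (fun_group G Y) A"
    and u: "u \<in> generate (fun_group G Y) A"
  shows "conj_fun G Y g u \<in> generate (fun_group G Y) A"
proof -
  interpret F: group "fun_group G Y" by (rule group_fun_group)
  interpret c: group_hom "fun_group G Y" "fun_group G Y" "conj_fun G Y g" by (rule group_hom_conj_fun[OF g])
  have "conj_fun G Y g u \<in> generate (fun_group G Y) (conj_fun G Y g ` A)"
    unfolding c.generate_img[OF A] using u by (rule imageI)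
  moreover have "generate (fun_group G Y) (conj_fun G Y g ` A) \<subseteq> generate (fun_group G Y) A"
    using gA by (intro F.generate_subgroup_incl F.generate_is_subgroup[OF A]) blast
  ultimately show ?thesis by blast
qed

text \<open>A finite direct power of a Noetherian group is Noetherian. The induction enlarges the set \<open>S\<close> of
  coordinates at which elements of \<open>K\<close> may be nontrivial.\<close>

lemma fg_subgroup_finite_power:
  assumes noeth: "noetherian_group G" and I: "finite I" and K: "subgroup K (fun_group G I)"
  shows "fg_subgroup (fun_group G I) K"
proof -
  interpret F: group "fun_group G I" by (rule group_fun_group)
  have "fg_subgroup (fun_group G I) K"
    if "finite S" "S \<subseteq> I" "subgroup K (fun_group G I)" "\<And>f i. f \<in> K \<Longrightarrow> i \<in> I - S \<Longrightarrow> f i = \<one>" for S K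
    using that
  proof (induction S arbitrary: K)
    case empty
    have "f = \<one>\<^bsub>fun_group G I\<^esub>" if "f \<in> K" for f
    proof (rule extensionalityI)
      have "f \<in> I \<rightarrow>\<^sub>E carrier G" using subgroup.subset[OF empty(2)] that by auto
      then show "f \<in> extensional I" by (simp add: PiE_iff)
    qed (use that empty(3) in auto)
    then have "K = {\<one>\<^bsub>fun_group G I\<^esub>}" using subgroup.one_closed[OF empty(2)] by blast
    then have "K = generate (fun_group G I) {}" by (simp only: F.generate_empty)
    then show ?case using F.fg_subgroup_generate_finite[of "{}"] by simp
  next
    case (insert s S)
    interpret e: group_hom "fun_group G I" G "\<lambda>f. f s" using insert.prems by (intro group_hom_eval) auto
    let ?L = "kernel (fun_group G I) G (\<lambda>f. f s)"
    have L: "subgroup (K \<inter> ?L) (fun_group G I)"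
      by (intro F.subgroups_Inter_pair insert.prems e.subgroup_kernel)
    show ?case
    proof (rule e.fg_subgroup_extension[OF insert.prems(2)])
      show "fg_subgroup G ((\<lambda>f. f s) ` K)"
        using noeth e.subgroup_img_is_subgroup[OF insert.prems(2)] by (simp add: noetherian_group_iff)
      show "fg_subgroup (fun_group G I) (K \<inter> ?L)"
      proof (rule insert.IH[OF _ L])
        show "f i = \<one>" if "f \<in> K \<inter> ?L" "i \<in> I - S" for f i
          using that insert.prems(3)[of f i] by (cases "i = s") (auto simp: kernel_def)
      qed (use insert.prems in auto)
    qed
  qed
  from this[OF I _ K] show ?thesis by simp
qed

text \<open>Modulo \<open>derived G N\<close>, finitely many of the conjugates of \<open>f\<close> generate all of them. It is enough to
  treat the inclusion of \<open>N\<close>, whose conjugates are the restrictions to \<open>N\<close> of the inner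
  automorphisms, because composition with \<open>f\<close> is a homomorphism of function groups. Let \<open>S\<close> be a
  finite generating set of \<open>N\<close>. The restrictions of the inner automorphisms to \<open>S\<close> lie in the
  Noetherian group of functions from \<open>S\<close> to \<open>G\<close>, so finitely many of them, indexed by \<open>K\<close>, generate
  the same subgroup as all of them. Hence every inner automorphism agrees on \<open>S\<close> with some word \<open>u\<close>
  in those indexed by \<open>K\<close>. As \<open>N\<close> is commutative modulo \<open>derived G N\<close>, the word \<open>u\<close> is a
  homomorphism modulo \<open>derived G N\<close>, and the agreement modulo \<open>derived G N\<close> spreads from \<open>S\<close> to \<open>N\<close>.\<close>

lemma conj_fun_mod_derived:
  assumes noeth: "noetherian_group G" and N: "N \<lhd> G"
    and f: "f \<in> Y \<rightarrow>\<^sub>E N"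
  shows "\<exists>K. finite K \<and> K \<subseteq> carrier G \<and>
    (\<forall>h\<in>carrier G. \<exists>c\<in>Y \<rightarrow>\<^sub>E derived G N.
      \<exists>w\<in>generate (fun_group G Y) ((\<lambda>i. conj_fun G Y i f) ` K).
        conj_fun G Y h f = c \<otimes>\<^bsub>fun_group G Y\<^esub> w)"
proof -
  let ?D = "derived G N"
  let ?\<alpha> = "\<lambda>h. \<lambda>a\<in>N. h \<otimes> a \<otimes> inv h"
  note Nsub = normal_imp_subgroup[OF N]
  have Nc: "N \<subseteq> carrier G" using subgroup.subset[OF Nsub] .
  have D: "?D \<lhd> G" by (rule derived_is_normal[OF N])
  interpret D: normal ?D G by (rule D)
  interpret q: group_hom G "G Mod ?D" "\<lambda>a. ?D #> a" by (rule D.group_hom_r_coset)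
  obtain S where S: "finite S" "S \<subseteq> carrier G" "generate G S = N"
    using noeth Nsub unfolding noetherian_group_iff fg_subgroup_def by blast
  have SN: "S \<subseteq> N" using S(3) generate.incl[of _ S G] by auto
  have aN: "h \<otimes> a \<otimes> inv h \<in> N" if "h \<in> carrier G" "a \<in> N" for h a
    using normal.inv_op_closed2[OF N that] .
  interpret FN: group "fun_group G N" by (rule group_fun_group)
  interpret FS: group "fun_group G S" by (rule group_fun_group)
  interpret FY: group "fun_group G Y" by (rule group_fun_group)
  have \<alpha>: "?\<alpha> h \<in> carrier (fun_group G N)" if "h \<in> carrier G" for h
    using that Nc by auto
  interpret r: group_hom "fun_group G N" "fun_group G S" "\<lambda>u. \<lambda>s\<in>S. u s"
    using SN by (intro group_hom_precompose) auto
  interpret p: group_hom "fun_group G N" "fun_group G Y" "\<lambda>u. \<lambda>y\<in>Y. u (f y)"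
    using f by (intro group_hom_precompose) auto
  let ?r = "\<lambda>u. \<lambda>s\<in>S. u s" and ?p = "\<lambda>u. \<lambda>y\<in>Y. u (f y)"
  let ?V = "?r ` ?\<alpha> ` carrier G"
  have V: "?V \<subseteq> carrier (fun_group G S)" using \<alpha> r.hom_closed by blast
  have "fg_subgroup (fun_group G S) (generate (fun_group G S) ?V)"
    by (rule fg_subgroup_finite_power[OF noeth S(1) FS.generate_is_subgroup[OF V]])
  then obtain W where W: "finite W" "W \<subseteq> ?V" "generate (fun_group G S) W = generate (fun_group G S) ?V"
    using FS.fg_subgroup_finite_subset[OF V] by blast
  \<comment> \<open>Finite generation of the span of all restrictions selects the finite set \<open>K\<close>.\<close>
  obtain A where A: "A \<subseteq> ?\<alpha> ` carrier G" "finite A" "W = ?r ` A"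
    using finite_subset_image[OF W(1,2)] that by (elim exE conjE)
  obtain K where K: "K \<subseteq> carrier G" "finite K" "A = ?\<alpha> ` K"
    using finite_subset_image[OF A(2,1)] that by (elim exE conjE)
  have \<alpha>K: "?\<alpha> ` K \<subseteq> carrier (fun_group G N)" using \<alpha> K(1) by blast
  have comm: "(?D #> x) \<otimes>\<^bsub>G Mod ?D\<^esub> (?D #> y) = (?D #> y) \<otimes>\<^bsub>G Mod ?D\<^esub> (?D #> x)"
    if "x \<in> N" "y \<in> N" for x y
  proof -
    have xy: "x \<in> carrier G" "y \<in> carrier G" using that Nc by auto
    have "x \<otimes> y \<otimes> inv x \<otimes> inv y \<in> ?D"
      using that generate.incl[of _ "derived_set G N" G] by (auto simp: derived_def)
    then have "?D #> (x \<otimes> y) = ?D #> (y \<otimes> x)"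
      using xy r_coset_eq_iff[OF D, of "x \<otimes> y" "y \<otimes> x"] commutator_conv[OF xy] by simp
    then show ?thesis using q.hom_mult[OF xy] q.hom_mult[OF xy(2,1)] by simp
  qed
  let ?GN = "G\<lparr>carrier := N\<rparr>"
  interpret GN: group ?GN by (rule subgroup_imp_group[OF Nsub])
  have hom_conj: "(\<lambda>a. ?D #> (h \<otimes> a \<otimes> inv h)) \<in> hom ?GN (G Mod ?D)" if h: "h \<in> carrier G" for h
  proof (rule homI)
    fix a b assume "a \<in> carrier ?GN" "b \<in> carrier ?GN"
    then have ab: "a \<in> carrier G" "b \<in> carrier G" using Nc by auto
    then show "?D #> (h \<otimes> (a \<otimes>\<^bsub>?GN\<^esub> b) \<otimes> inv h)
        = (?D #> (h \<otimes> a \<otimes> inv h)) \<otimes>\<^bsub>G Mod ?D\<^esub> (?D #> (h \<otimes> b \<otimes> inv h))"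
      using h q.hom_mult[of "h \<otimes> a \<otimes> inv h" "h \<otimes> b \<otimes> inv h"] conj_product[OF h ab] by simp
  next
    fix a assume "a \<in> carrier ?GN"
    then have "h \<otimes> a \<otimes> inv h \<in> carrier G" using h Nc by auto
    then show "?D #> (h \<otimes> a \<otimes> inv h) \<in> carrier (G Mod ?D)" by (rule q.hom_closed)
  qed
  \<comment> \<open>A pointwise product of homomorphisms is again one if the target is commutative.\<close>
  have words: "(\<forall>a\<in>N. u a \<in> N) \<and> (\<lambda>a. ?D #> u a) \<in> hom ?GN (G Mod ?D)"
    if "u \<in> generate (fun_group G N) (?\<alpha> ` K)" for u
    using that
  proof induction
    case one
    have val: "\<one>\<^bsub>fun_group G N\<^esub> a = \<one>" if "a \<in> N" for a using that by simp
    have "(\<lambda>a. ?D #> \<one>\<^bsub>fun_group G N\<^esub> a) \<in> hom ?GN (G Mod ?D)"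
    proof (rule homI)
      fix a b assume ab: "a \<in> carrier ?GN" "b \<in> carrier ?GN"
      then have "a \<in> N" "b \<in> N" "a \<otimes>\<^bsub>?GN\<^esub> b \<in> N" using GN.m_closed[OF ab] by simp_all
      moreover have "?D #> \<one> = (?D #> \<one>) \<otimes>\<^bsub>G Mod ?D\<^esub> (?D #> \<one>)"
        using q.hom_mult[of \<one> \<one>] by simp
      ultimately show "?D #> \<one>\<^bsub>fun_group G N\<^esub> (a \<otimes>\<^bsub>?GN\<^esub> b)
          = (?D #> \<one>\<^bsub>fun_group G N\<^esub> a) \<otimes>\<^bsub>G Mod ?D\<^esub> (?D #> \<one>\<^bsub>fun_group G N\<^esub> b)"
        by (simp only: val)
    next
      fix a assume "a \<in> carrier ?GN"
      then show "?D #> \<one>\<^bsub>fun_group G N\<^esub> a \<in> carrier (G Mod ?D)" using q.hom_closed[of \<one>] by simp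
    qed
    then show ?case using val subgroup.one_closed[OF Nsub] by simp
  next
    case (incl u)
    then obtain h where h: "h \<in> carrier G" "u = ?\<alpha> h" using K(1) by blast
    have "(\<lambda>a. ?D #> u a) \<in> hom ?GN (G Mod ?D)"
      by (rule GN.hom_restrict[OF hom_conj[OF h(1)]]) (simp add: h(2))
    then show ?case using h aN by simp
  next
    case (inv u)
    then obtain h where h: "h \<in> carrier G" "u = ?\<alpha> h" using K(1) by blast
    let ?b = "\<lambda>a. h \<otimes> a \<otimes> inv h"
    have val: "(inv\<^bsub>fun_group G N\<^esub> u) a = inv (?b a)" if "a \<in> N" for a
      using \<alpha>[OF h(1)] h is_group that by simp
    have N': "inv (?b a) \<in> N" if "a \<in> N" for a
      by (rule subgroup.m_inv_closed[OF Nsub aN[OF h(1) that]])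
    have "(\<lambda>a. ?D #> (inv\<^bsub>fun_group G N\<^esub> u) a) \<in> hom ?GN (G Mod ?D)"
    proof (rule homI)
      fix a assume "a \<in> carrier ?GN"
      then have "inv (?b a) \<in> carrier G" "a \<in> N" using N' Nc by auto
      then show "?D #> (inv\<^bsub>fun_group G N\<^esub> u) a \<in> carrier (G Mod ?D)" using q.hom_closed val by simp
    next
      fix a b assume ab: "a \<in> carrier ?GN" "b \<in> carrier ?GN"
      then have abN: "a \<in> N" "b \<in> N" and abc: "a \<in> carrier G" "b \<in> carrier G" using Nc by auto
      have "a \<otimes> b \<in> N" using GN.m_closed[OF ab] by simp
      then have "?D #> (inv\<^bsub>fun_group G N\<^esub> u) (a \<otimes> b) = ?D #> inv (?b a \<otimes> ?b b)"
        using val conj_product[OF h(1) abc] by simp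
      also have "\<dots> = ?D #> (inv (?b b) \<otimes> inv (?b a))"
        using h(1) abc inv_mult_group[of "?b a" "?b b"] by simp
      also have "\<dots> = (?D #> inv (?b b)) \<otimes>\<^bsub>G Mod ?D\<^esub> (?D #> inv (?b a))"
        using h(1) abc by (intro q.hom_mult) auto
      also have "\<dots> = (?D #> inv (?b a)) \<otimes>\<^bsub>G Mod ?D\<^esub> (?D #> inv (?b b))"
        by (rule comm[OF N'[OF abN(2)] N'[OF abN(1)]])
      finally show "?D #> (inv\<^bsub>fun_group G N\<^esub> u) (a \<otimes>\<^bsub>?GN\<^esub> b)
          = (?D #> (inv\<^bsub>fun_group G N\<^esub> u) a) \<otimes>\<^bsub>G Mod ?D\<^esub> (?D #> (inv\<^bsub>fun_group G N\<^esub> u) b)"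
        using val abN by simp
    qed
    then show ?case using val N' by simp
  next
    case (eng u v)
    have u: "\<And>a. a \<in> N \<Longrightarrow> u a \<in> N" "(\<lambda>a. ?D #> u a) \<in> hom ?GN (G Mod ?D)"
      and v: "\<And>a. a \<in> N \<Longrightarrow> v a \<in> N" "(\<lambda>a. ?D #> v a) \<in> hom ?GN (G Mod ?D)"
      using eng.IH by auto
    have val: "?D #> (u \<otimes>\<^bsub>fun_group G N\<^esub> v) a = (?D #> u a) \<otimes>\<^bsub>G Mod ?D\<^esub> (?D #> v a)"
      if "a \<in> N" for a
    proof -
      have "u a \<in> carrier G" "v a \<in> carrier G" using u(1) v(1) that Nc by auto
      from q.hom_mult[OF this] show ?thesis using that by simp
    qed
    have "(\<lambda>a. ?D #> (u \<otimes>\<^bsub>fun_group G N\<^esub> v) a) \<in> hom ?GN (G Mod ?D)"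
    proof (rule homI)
      fix a assume a: "a \<in> carrier ?GN"
      then have "a \<in> N" by simp
      from val[OF this] show "?D #> (u \<otimes>\<^bsub>fun_group G N\<^esub> v) a \<in> carrier (G Mod ?D)"
        using hom_in_carrier[OF u(2) a] hom_in_carrier[OF v(2) a] q.H.m_closed by simp
    next
      fix a b assume ab: "a \<in> carrier ?GN" "b \<in> carrier ?GN"
      then have abN: "a \<in> N" "b \<in> N" by simp_all
      note uc = hom_in_carrier[OF u(2) ab(1)] hom_in_carrier[OF u(2) ab(2)]
      note vc = hom_in_carrier[OF v(2) ab(1)] hom_in_carrier[OF v(2) ab(2)]
      have abm: "a \<otimes>\<^bsub>?GN\<^esub> b \<in> N" using GN.m_closed[OF ab] by simp
      let ?u = "\<lambda>a. ?D #> u a" and ?v = "\<lambda>a. ?D #> v a"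
      have "?D #> (u \<otimes>\<^bsub>fun_group G N\<^esub> v) (a \<otimes>\<^bsub>?GN\<^esub> b)
          = (?u a \<otimes>\<^bsub>G Mod ?D\<^esub> ?u b) \<otimes>\<^bsub>G Mod ?D\<^esub> (?v a \<otimes>\<^bsub>G Mod ?D\<^esub> ?v b)"
        unfolding val[OF abm] hom_mult[OF u(2) ab] hom_mult[OF v(2) ab] ..
      also have "\<dots> = ?u a \<otimes>\<^bsub>G Mod ?D\<^esub> (?u b \<otimes>\<^bsub>G Mod ?D\<^esub> ?v a) \<otimes>\<^bsub>G Mod ?D\<^esub> ?v b"
        using uc vc by (simp only: q.H.m_assoc q.H.m_closed)
      also have "?u b \<otimes>\<^bsub>G Mod ?D\<^esub> ?v a = ?v a \<otimes>\<^bsub>G Mod ?D\<^esub> ?u b"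
        by (rule comm[OF u(1)[OF abN(2)] v(1)[OF abN(1)]])
      also have "?u a \<otimes>\<^bsub>G Mod ?D\<^esub> (?v a \<otimes>\<^bsub>G Mod ?D\<^esub> ?u b) \<otimes>\<^bsub>G Mod ?D\<^esub> ?v b
          = (?u a \<otimes>\<^bsub>G Mod ?D\<^esub> ?v a) \<otimes>\<^bsub>G Mod ?D\<^esub> (?u b \<otimes>\<^bsub>G Mod ?D\<^esub> ?v b)"
        using uc vc by (simp only: q.H.m_assoc q.H.m_closed)
      finally show "?D #> (u \<otimes>\<^bsub>fun_group G N\<^esub> v) (a \<otimes>\<^bsub>?GN\<^esub> b)
          = (?D #> (u \<otimes>\<^bsub>fun_group G N\<^esub> v) a) \<otimes>\<^bsub>G Mod ?D\<^esub> (?D #> (u \<otimes>\<^bsub>fun_group G N\<^esub> v) b)"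
        unfolding val[OF abN(1)] val[OF abN(2)] .
    qed
    moreover have "(u \<otimes>\<^bsub>fun_group G N\<^esub> v) a \<in> N" if "a \<in> N" for a
      using u(1)[OF that] v(1)[OF that] subgroup.m_closed[OF Nsub] that by simp
    ultimately show ?case by blast
  qed
  have "\<exists>c\<in>Y \<rightarrow>\<^sub>E ?D. \<exists>w\<in>generate (fun_group G Y) ((\<lambda>i. conj_fun G Y i f) ` K).
      conj_fun G Y h f = c \<otimes>\<^bsub>fun_group G Y\<^esub> w" if h: "h \<in> carrier G" for h
  proof -
    have "?r (?\<alpha> h) \<in> generate (fun_group G S) (?r ` ?\<alpha> ` K)"
      using h W(3) generate.incl[of "?r (?\<alpha> h)" ?V "fun_group G S"] unfolding A(3) K(3) by blast
    then obtain u where u: "u \<in> generate (fun_group G N) (?\<alpha> ` K)" "?r (?\<alpha> h) = ?r u"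
      unfolding r.generate_img[OF \<alpha>K] by blast
    have uN: "u a \<in> N" if "a \<in> N" for a using words[OF u(1)] that by blast
    have eqS: "?D #> u s = ?D #> (h \<otimes> s \<otimes> inv h)" if "s \<in> S" for s
      using fun_cong[OF u(2), of s] that SN by (simp add: subset_iff)
    have eqN: "?D #> u a = ?D #> (h \<otimes> a \<otimes> inv h)" if "a \<in> N" for a
    proof (rule hom_eq_on_generate[where G = ?GN and H = "G Mod ?D" and S = S and x = a
          and h = "\<lambda>a. ?D #> u a" and k = "\<lambda>a. ?D #> (h \<otimes> a \<otimes> inv h)"])
      show "group_hom ?GN (G Mod ?D) (\<lambda>a. ?D #> u a)"
        using words[OF u(1)] by (intro group_hom.intro group_hom_axioms.intro GN.is_group q.H.is_group) blast
      show "group_hom ?GN (G Mod ?D) (\<lambda>a. ?D #> (h \<otimes> a \<otimes> inv h))"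
        using hom_conj[OF h] by (intro group_hom.intro group_hom_axioms.intro GN.is_group q.H.is_group)
      show "S \<subseteq> carrier ?GN" using SN by simp
      show "a \<in> generate ?GN S" using that generate_consistent[OF SN Nsub] S(3) by simp
    qed (rule eqS)
    let ?c = "\<lambda>y\<in>Y. (h \<otimes> f y \<otimes> inv h) \<otimes> inv (u (f y))"
    have fy: "f y \<in> N" if "y \<in> Y" for y using f that by auto
    have "?c \<in> Y \<rightarrow>\<^sub>E ?D"
    proof -
      have "(h \<otimes> f y \<otimes> inv h) \<otimes> inv (u (f y)) \<in> ?D" if y: "y \<in> Y" for y
        using eqN[OF fy[OF y]] uN[OF fy[OF y]] aN[OF h fy[OF y]] Nc
          r_coset_eq_iff[OF D, of "h \<otimes> f y \<otimes> inv h" "u (f y)"] by auto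
      then show ?thesis by auto
    qed
    moreover have "?p u \<in> generate (fun_group G Y) ((\<lambda>i. conj_fun G Y i f) ` K)"
    proof -
      have "?p (?\<alpha> i) = conj_fun G Y i f" for i
        using fy by (auto simp: conj_fun_def fun_eq_iff)
      then have "(\<lambda>i. conj_fun G Y i f) ` K = ?p ` ?\<alpha> ` K" by (simp add: image_image)
      then show ?thesis using u(1) p.generate_img[OF \<alpha>K] by simp
    qed
    moreover have "conj_fun G Y h f = ?c \<otimes>\<^bsub>fun_group G Y\<^esub> ?p u"
    proof -
      have "h \<otimes> f y \<otimes> inv h = (h \<otimes> f y \<otimes> inv h) \<otimes> inv (u (f y)) \<otimes> u (f y)" if "y \<in> Y" for y
      proof -
        have "u (f y) \<in> carrier G" "h \<otimes> f y \<otimes> inv h \<in> carrier G"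
          using uN[OF fy[OF that]] aN[OF h fy[OF that]] Nc by auto
        then show ?thesis by (simp add: m_assoc)
      qed
      then show ?thesis by (auto simp: conj_fun_def fun_eq_iff)
    qed
    ultimately show ?thesis by blast
  qed
  then show ?thesis using K(1,2) by blast
qed

end

context group
begin

lemma conj_fun_invariant_generate:
  assumes T: "T \<subseteq> carrier G" and A: "A \<subseteq> carrier (fun_group G Y)"
    and inv: "\<And>t u. t \<in> T \<Longrightarrow> u \<in> A \<Longrightarrow> conj_fun G Y t u \<in> generate (fun_group G Y) A"
      "\<And>t u. t \<in> T \<Longrightarrow> u \<in> A \<Longrightarrow> conj_fun G Y (inv t) u \<in> generate (fun_group G Y) A"
    and g: "g \<in> generate G T" and u: "u \<in> generate (fun_group G Y) A"
  shows "conj_fun G Y g u \<in> generate (fun_group G Y) A"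
  using g u
proof (induction arbitrary: u)
  interpret F: group "fun_group G Y" by (rule group_fun_group)
  have uF: "u \<in> carrier (fun_group G Y)" if "u \<in> generate (fun_group G Y) A" for u
    using F.generate_in_carrier[OF A that] .
  { case one
    then show ?case by (simp only: conj_fun_one[OF uF])
  next
    case (incl t)
    then show ?case using T by (intro conj_fun_generate[OF _ A inv(1)]) auto
  next
    case (inv t)
    then show ?case using T by (intro conj_fun_generate[OF _ A assms(4)]) auto
  next
    case (eng g h)
    then have "g \<in> carrier G" "h \<in> carrier G" using generate_in_carrier[OF T] by auto
    then show ?case using conj_fun_conj_fun[of g h u Y] uF[OF eng.prems] eng.IH(1)[OF eng.IH(2)[OF eng.prems]] by simp
  }
qed

text \<open>Induction on the derived length of \<open>N\<close>. Take \<open>K\<close> as in \<open>conj_fun_mod_derived\<close>, with \<open>1\<close>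
  added, and a finite generating set \<open>T\<close> of \<open>G\<close>. Conjugating one of the finitely many functions
  indexed by \<open>K\<close> by an element of \<open>T\<close> or its inverse gives a word in these functions times a
  correction \<open>c\<close> with values in \<open>derived G N\<close>. Only finitely many corrections arise, and by induction
  the orbit of each generates a finitely generated group. These orbits and the functions indexed by
  \<open>K\<close> generate a subgroup that is invariant under \<open>T\<close>, hence under \<open>G\<close>; as it contains \<open>f\<close>, it
  contains the whole orbit of \<open>f\<close>, and in fact the orbit generates it.\<close>

theorem fg_subgroup_generate_conj_orbit:
  assumes noeth: "noetherian_group G"
    and "N \<lhd> G" "(derived G ^^ k) N = {\<one>}" "f \<in> Y \<rightarrow>\<^sub>E N"
  shows "fg_subgroup (fun_group G Y) (generate (fun_group G Y) (conj_orbit G Y f))"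
  using assms(2-)
proof (induction k arbitrary: N f)
  interpret F: group "fun_group G Y" by (rule group_fun_group)
  {
  case 0
  then have f: "f \<in> carrier (fun_group G Y)" and f1: "f = (\<lambda>y\<in>Y. \<one>)"
    by (auto simp: PiE_iff intro: extensionalityI[of _ Y])
  have "conj_orbit G Y f \<subseteq> {f}"
    by (auto simp: conj_orbit_def conj_fun_def f1)
  then have "finite (conj_orbit G Y f)" using finite_subset by blast
  then show ?case by (rule F.fg_subgroup_generate_finite[OF _ conj_orbit_subset[OF f]])
next
  case (Suc k)
  let ?gen = "generate (fun_group G Y)" and ?D = "derived G N"
  note N = \<open>N \<lhd> G\<close> and f = \<open>f \<in> Y \<rightarrow>\<^sub>E N\<close>
  have Nc: "N \<subseteq> carrier G" using subgroup.subset[OF normal_imp_subgroup[OF N]] .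
  have fF: "f \<in> carrier (fun_group G Y)" using f Nc by (auto simp: PiE_iff)
  have D: "?D \<lhd> G" by (rule derived_is_normal[OF N])
  have Dc: "?D \<subseteq> carrier G" using subgroup.subset[OF normal_imp_subgroup[OF D]] .
  have IH: "fg_subgroup (fun_group G Y) (?gen (conj_orbit G Y c))" if "c \<in> Y \<rightarrow>\<^sub>E ?D" for c
    using Suc.IH[OF D _ that] Suc.prems(2) by (simp add: funpow_swap1)
  obtain T where T: "finite T" "T \<subseteq> carrier G" "generate G T = carrier G"
    using noeth subgroup_self unfolding noetherian_group_iff fg_subgroup_def by blast
  obtain K where K: "finite K" "K \<subseteq> carrier G"
    and decomp: "\<And>h. h \<in> carrier G \<Longrightarrow> \<exists>c\<in>Y \<rightarrow>\<^sub>E ?D. \<exists>w\<in>?gen ((\<lambda>i. conj_fun G Y i f) ` K).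
        conj_fun G Y h f = c \<otimes>\<^bsub>fun_group G Y\<^esub> w"
    using conj_fun_mod_derived[OF noeth N f] by blast
  obtain c w where cw: "\<And>h. h \<in> carrier G \<Longrightarrow> c h \<in> Y \<rightarrow>\<^sub>E ?D"
      "\<And>h. h \<in> carrier G \<Longrightarrow> w h \<in> ?gen ((\<lambda>i. conj_fun G Y i f) ` K)"
      "\<And>h. h \<in> carrier G \<Longrightarrow> conj_fun G Y h f = c h \<otimes>\<^bsub>fun_group G Y\<^esub> w h"
    using decomp by metis
  \<comment> \<open>Adding \<open>1\<close> to \<open>K\<close> puts \<open>f\<close> itself among the generators.\<close>
  let ?K = "insert \<one> K" and ?T = "T \<union> (\<lambda>t. inv t) ` T"
  let ?E = "(\<lambda>i. conj_fun G Y i f) ` ?K"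
  let ?P = "(\<lambda>(t, i). t \<otimes> i) ` (?T \<times> ?K)"
  let ?C = "\<Union>h\<in>?P. conj_orbit G Y (c h)"
  have Kc: "?K \<subseteq> carrier G" and Tc: "?T \<subseteq> carrier G" using K(2) T(2) by auto
  have Pc: "?P \<subseteq> carrier G" using Kc Tc by (auto simp: subset_iff)
  have cF: "c h \<in> carrier (fun_group G Y)" if "h \<in> carrier G" for h
    using cw(1)[OF that] Dc by (auto simp: PiE_iff)
  have EO: "?E \<subseteq> conj_orbit G Y f" using Kc unfolding conj_orbit_def by (rule image_mono)
  have EF: "?E \<subseteq> carrier (fun_group G Y)" using EO conj_orbit_subset[OF fF] by (rule subset_trans)
  have CF: "?C \<subseteq> carrier (fun_group G Y)" using conj_orbit_subset[OF cF] Pc by (intro UN_least) auto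
  note ECF = Un_least[OF EF CF]
  have fg: "fg_subgroup (fun_group G Y) (?gen (?E \<union> ?C))"
  proof (rule F.fg_subgroup_generate_Un[OF EF CF])
    show "fg_subgroup (fun_group G Y) (?gen ?E)"
      using K(1) by (intro F.fg_subgroup_generate_finite[OF _ EF]) simp
    show "fg_subgroup (fun_group G Y) (?gen ?C)"
    proof (rule F.fg_subgroup_generate_Union)
      show "finite ?P" using T(1) K(1) by simp
      show "conj_orbit G Y (c h) \<subseteq> carrier (fun_group G Y)" if "h \<in> ?P" for h
        by (rule conj_orbit_subset[OF cF[OF subsetD[OF Pc that]]])
      show "fg_subgroup (fun_group G Y) (?gen (conj_orbit G Y (c h)))" if "h \<in> ?P" for h
        by (rule IH[OF cw(1)[OF subsetD[OF Pc that]]])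
    qed
  qed
  have KE: "(\<lambda>i. conj_fun G Y i f) ` K \<subseteq> ?E" by blast
  have wgen: "w h \<in> ?gen (?E \<union> ?C)" if "h \<in> carrier G" for h
    using cw(2)[OF that] F.mono_generate[OF subset_trans[OF KE Un_upper1]] by (rule subsetD[rotated])
  have invariant: "conj_fun G Y t u \<in> ?gen (?E \<union> ?C)" if t: "t \<in> ?T" and u: "u \<in> ?E \<union> ?C" for t u
    using u
  proof
    assume "u \<in> ?E"
    then obtain i where i: "i \<in> ?K" "u = conj_fun G Y i f" by blast
    have tc: "t \<in> carrier G" and ic: "i \<in> carrier G" using t i(1) Tc Kc by auto
    have P: "t \<otimes> i \<in> ?P" using t i(1) by (intro image_eqI[of _ _ "(t, i)"]) simp_all
    have "c (t \<otimes> i) \<in> ?C" using P self_in_conj_orbit[OF cF[OF subsetD[OF Pc P]]] by blast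
    then have "c (t \<otimes> i) \<in> ?gen (?E \<union> ?C)" by (intro generate.incl UnI2)
    then have "c (t \<otimes> i) \<otimes>\<^bsub>fun_group G Y\<^esub> w (t \<otimes> i) \<in> ?gen (?E \<union> ?C)"
      using wgen tc ic by (intro generate.eng) auto
    then show ?thesis
      unfolding i(2) conj_fun_conj_fun[OF tc ic fF] cw(3)[OF m_closed[OF tc ic]] .
  next
    assume "u \<in> ?C"
    then obtain h where h: "h \<in> ?P" "u \<in> conj_orbit G Y (c h)" by blast
    have "conj_fun G Y t u \<in> conj_orbit G Y (c h)"
      using t Tc h Pc cF by (intro conj_fun_conj_orbit) auto
    then show ?thesis using h(1) by (intro generate.incl UnI2 UN_I)
  qed
  have closed: "conj_fun G Y g u \<in> ?gen (?E \<union> ?C)" if "g \<in> carrier G" "u \<in> ?gen (?E \<union> ?C)" for g u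
    using T(2) ECF _ _ _ that(2)
  proof (rule conj_fun_invariant_generate)
    show "g \<in> generate G T" using that(1) T(3) by simp
  qed (rule invariant; blast)+
  have "f \<in> ?E" using conj_fun_one[OF fF] by force
  then have "f \<in> ?gen (?E \<union> ?C)" by (intro generate.incl UnI1)
  then have sub1: "conj_orbit G Y f \<subseteq> ?gen (?E \<union> ?C)" using closed unfolding conj_orbit_def by blast
  note orbF = conj_orbit_subset[OF fF]
  have gen_sub: "?gen ?E \<subseteq> ?gen (conj_orbit G Y f)" by (rule F.mono_generate[OF EO])
  \<comment> \<open>No correction leaves the group generated by the orbit, as it is a quotient of two of its elements.\<close>
  have "c h \<in> ?gen (conj_orbit G Y f)" if h: "h \<in> carrier G" for h
  proof -
    have "w h \<in> ?gen ?E" using cw(2)[OF h] F.mono_generate[OF KE] by blast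
    then have w: "w h \<in> ?gen (conj_orbit G Y f)" using gen_sub by blast
    have "conj_fun G Y h f \<in> ?gen (conj_orbit G Y f)"
      using h by (intro generate.incl) (simp add: conj_orbit_def)
    then have "conj_fun G Y h f \<otimes>\<^bsub>fun_group G Y\<^esub> inv\<^bsub>fun_group G Y\<^esub> w h \<in> ?gen (conj_orbit G Y f)"
      by (rule generate.eng[OF _ F.generate_m_inv_closed[OF orbF w]])
    moreover have wF: "w h \<in> carrier (fun_group G Y)" by (rule F.generate_in_carrier[OF orbF w])
    have "conj_fun G Y h f \<otimes>\<^bsub>fun_group G Y\<^esub> inv\<^bsub>fun_group G Y\<^esub> w h = c h"
      unfolding cw(3)[OF h] F.m_assoc[OF cF[OF h] wF F.inv_closed[OF wF]] F.r_inv[OF wF]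
      by (rule F.r_one[OF cF[OF h]])
    ultimately show ?thesis by simp
  qed
  then have "conj_orbit G Y (c h) \<subseteq> ?gen (conj_orbit G Y f)" if "h \<in> carrier G" for h
    unfolding conj_orbit_def[of G Y "c h"]
    using conj_fun_generate[OF _ orbF generate.incl[OF conj_fun_conj_orbit[OF _ fF]]] that by blast
  then have "?C \<subseteq> ?gen (conj_orbit G Y f)" using Pc by blast
  moreover have "?E \<subseteq> ?gen (conj_orbit G Y f)"
    by (rule subset_trans[OF EO]) (rule subsetI, rule generate.incl)
  ultimately have "?gen (?E \<union> ?C) = ?gen (conj_orbit G Y f)"
    by (intro F.generate_eqI ECF orbF sub1 Un_least)
  then show ?case using fg by simp
  }
qed

lemma derived_series_fun_group:
  assumes "(derived G ^^ k) (carrier G) = {\<one>}"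
  shows "(derived (fun_group G Y) ^^ k) (carrier (fun_group G Y)) = {\<one>\<^bsub>fun_group G Y\<^esub>}"
proof -
  interpret F: group "fun_group G Y" by (rule group_fun_group)
  let ?D = "(derived (fun_group G Y) ^^ k) (carrier (fun_group G Y))"
  have D: "subgroup ?D (fun_group G Y)" by (rule F.exp_of_derived_is_subgroup[OF F.subgroup_self])
  have "p = \<one>\<^bsub>fun_group G Y\<^esub>" if p: "p \<in> ?D" for p
  proof (rule extensionalityI)
    have "p \<in> Y \<rightarrow>\<^sub>E carrier G" using subgroup.subset[OF D] p by auto
    then show "p \<in> extensional Y" by (simp add: PiE_iff)
    fix y assume y: "y \<in> Y"
    interpret e: group_hom "fun_group G Y" G "\<lambda>p. p y" by (rule group_hom_eval[OF y])
    have "p y \<in> (derived G ^^ k) ((\<lambda>p. p y) ` carrier (fun_group G Y))"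
      using p unfolding e.exp_of_derived_img[OF order_refl] by blast
    also have "\<dots> \<subseteq> (derived G ^^ k) (carrier G)"
      using e.hom_closed by (intro mono_exp_of_derived) blast
    finally show "p y = \<one>\<^bsub>fun_group G Y\<^esub> y" using assms y by simp
  qed simp
  then show ?thesis using subgroup.one_closed[OF D] by blast
qed

lemma solvable_fun_group: "solvable G \<Longrightarrow> solvable (fun_group G Y)"
  using derived_series_fun_group group.solvable_iff_trivial_derived_seq[OF group_fun_group]
    solvable_iff_trivial_derived_seq by metis

lemma solvable_subgroup_iff:
  assumes "subgroup H G"
  shows "solvable (G\<lparr>carrier := H\<rparr>) \<longleftrightarrow> solvable_seq G H"
proof -
  interpret H: group "G\<lparr>carrier := H\<rparr>" by (rule subgroup_imp_group[OF assms])
  interpret i: group_hom "G\<lparr>carrier := H\<rparr>" G id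
    using subgroup.subset[OF assms] is_group H.is_group
    by (intro group_hom.intro group_hom_axioms.intro) (auto simp: hom_def)
  show ?thesis
  proof
    assume "solvable (G\<lparr>carrier := H\<rparr>)"
    then show "solvable_seq G H" using i.solvable_imp_solvable_img unfolding solvable_def by fastforce
  next
    assume "solvable_seq G H"
    then show "solvable (G\<lparr>carrier := H\<rparr>)"
      using i.solvable_img_imp_solvable[OF H.subgroup_self] unfolding solvable_def by simp
  qed
qed

end

section \<open>Generators of the group of polynomial functions\<close>

definition coordinate :: "('a, 'b) monoid_scheme \<Rightarrow> nat \<Rightarrow> nat \<Rightarrow> (nat \<Rightarrow> 'a) \<Rightarrow> 'a" where
  "coordinate G n i = (\<lambda>t\<in>tuples G n. t i)"

definition poly_fun_gens :: "('a, 'b) monoid_scheme \<Rightarrow> nat \<Rightarrow> ((nat \<Rightarrow> 'a) \<Rightarrow> 'a) set" where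
  "poly_fun_gens G n = (\<Union>i\<in>{1..n}. conj_orbit G (tuples G n) (coordinate G n i))"

lemma presented_monoid_hom_in_subgroup:
  assumes h: "group_hom (presented_monoid A R) H h" and K: "subgroup K H"
    and gens: "\<And>a. a \<in> A \<Longrightarrow> h (word_class A R [a]) \<in> K"
    and Z: "Z \<in> carrier (presented_monoid A R)"
  shows "h Z \<in> K"
proof -
  interpret group_hom "presented_monoid A R" H h by (rule h)
  obtain w where w: "w \<in> lists A" "Z = word_class A R w"
    using Z by (auto simp: carrier_presented_monoid)
  have "h (word_class A R w) \<in> K" using w(1)
  proof (induction w)
    case Nil
    then show ?case using hom_one subgroup.one_closed[OF K] by (simp add: one_presented_monoid)
  next
    case (Cons a w)
    have c: "word_class A R [a] \<in> carrier (presented_monoid A R)"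
      "word_class A R w \<in> carrier (presented_monoid A R)"
      using Cons.hyps by (auto simp: carrier_presented_monoid)
    have "word_class A R (a # w) = word_class A R [a] \<otimes>\<^bsub>presented_monoid A R\<^esub> word_class A R w"
      using Cons.hyps by (simp add: mult_presented_monoid)
    then show ?case
      using hom_mult[OF c] gens[OF Cons.hyps(1)] Cons.IH subgroup.m_closed[OF K] by simp
  qed
  then show ?thesis by (simp add: w(2))
qed

lemma free_group_hom_in_subgroup:
  assumes h: "group_hom (free_group I) H h" and K: "subgroup K H"
    and gens: "\<And>i. i \<in> I \<Longrightarrow> h (free_gen I i) \<in> K" and Z: "Z \<in> carrier (free_group I)"
  shows "h Z \<in> K"
proof (rule presented_monoid_hom_in_subgroup[OF h[unfolded free_group_def] K _ Z[unfolded free_group_def]])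
  interpret group_hom "free_group I" H h by (rule h)
  let ?c = "word_class (I \<times> UNIV) (free_group_rels I)"
  fix a assume "a \<in> I \<times> (UNIV :: bool set)"
  then obtain i b where a: "a = (i, b)" "i \<in> I" by auto
  show "h (?c [a]) \<in> K"
  proof (cases b)
    case True
    then show ?thesis using a gens by (simp add: free_gen_def)
  next
    case False
    have c: "?c [(i, False)] \<in> carrier (free_group I)"
      using a by (auto simp: free_group_def carrier_presented_monoid)
    have "([(i, False), (i, \<not> False)], []) \<in> free_group_rels I"
      unfolding free_group_rels_def using a by blast
    then have "?c [(i, False), (i, True)] = ?c []"
      using a by (intro word_class_rel) auto
    then have "?c [(i, False)] \<otimes>\<^bsub>free_group I\<^esub> free_gen I i = \<one>\<^bsub>free_group I\<^esub>"
      using a by (simp add: free_group_def one_presented_monoid free_gen_def mult_presented_monoid)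
    then have "?c [(i, False)] = inv\<^bsub>free_group I\<^esub> free_gen I i"
      using G.inv_equality[OF _ free_gen_closed[OF a(2)] c] by simp
    then show ?thesis
      using a False gens[OF a(2)] free_gen_closed[OF a(2)] subgroup.m_inv_closed[OF K] by simp
  qed
qed

lemma free_product_hom_in_subgroup:
  assumes h: "group_hom (free_product G H) M h" and K: "subgroup K M"
    and "\<And>a. a \<in> carrier G \<Longrightarrow> h (free_product_inl G H a) \<in> K"
    and "\<And>b. b \<in> carrier H \<Longrightarrow> h (free_product_inr G H b) \<in> K"
    and Z: "Z \<in> carrier (free_product G H)"
  shows "h Z \<in> K"
  using assms(3,4)
  by (intro presented_monoid_hom_in_subgroup[OF h[unfolded free_product_def] K _
        Z[unfolded free_product_def]])
    (auto simp: free_product_inl_def free_product_inr_def)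

context group
begin

lemma coordinate_closed: "i \<in> {1..n} \<Longrightarrow> coordinate G n i \<in> carrier (fun_group G (tuples G n))"
  by (auto simp: coordinate_def tuples_def)

lemma group_hom_poly_fun: "group_hom (poly_group G n) (fun_group G (tuples G n)) (poly_fun G n)"
  by (intro group_hom.intro group_hom_axioms.intro group_poly_group group_fun_group poly_fun_hom)

lemma poly_fun_const:
  assumes "a \<in> carrier G" shows "poly_fun G n (poly_const G n a) = (\<lambda>t\<in>tuples G n. a)"
  unfolding poly_fun_def
  by (rule restrict_ext) (use assms is_substitution_substitution in \<open>auto simp: is_substitution_def\<close>)

lemma poly_fun_var:
  assumes "i \<in> {1..n}" shows "poly_fun G n (poly_var G n i) = coordinate G n i"
  unfolding poly_fun_def coordinate_def
  by (rule restrict_ext) (use assms is_substitution_substitution in \<open>auto simp: is_substitution_def\<close>)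

lemma poly_const_closed: "a \<in> carrier G \<Longrightarrow> poly_const G n a \<in> carrier (poly_group G n)"
  using hom_in_carrier[OF free_product_inl_hom[OF is_group group_free_group]]
  by (simp add: poly_const_def poly_group_def)

lemma poly_var_closed: "i \<in> {1..n} \<Longrightarrow> poly_var G n i \<in> carrier (poly_group G n)"
  using hom_in_carrier[OF free_product_inr_hom[OF is_group group_free_group[of "{1..n}"]]
      free_gen_closed[of i "{1..n}"]]
  by (simp add: poly_var_def poly_group_def)

lemma poly_fun_in_subgroup:
  assumes K: "subgroup K (fun_group G (tuples G n))"
    and const: "\<And>a. a \<in> carrier G \<Longrightarrow> (\<lambda>t\<in>tuples G n. a) \<in> K"
    and coord: "\<And>i. i \<in> {1..n} \<Longrightarrow> coordinate G n i \<in> K"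
    and Z: "Z \<in> carrier (poly_group G n)"
  shows "poly_fun G n Z \<in> K"
proof (rule free_product_hom_in_subgroup[OF group_hom_poly_fun[unfolded poly_group_def] K _ _
      Z[unfolded poly_group_def]])
  let ?F = "free_group {1..n}"
  show "poly_fun G n (free_product_inl G ?F a) \<in> K" if "a \<in> carrier G" for a
    using const[OF that] poly_fun_const[OF that] by (simp add: poly_const_def)
  have "free_product_inr G ?F \<in> hom ?F (poly_group G n)"
    unfolding poly_group_def by (rule free_product_inr_hom[OF is_group group_free_group])
  then have "poly_fun G n \<circ> free_product_inr G ?F \<in> hom ?F (fun_group G (tuples G n))"
    using poly_fun_hom by (rule Group.hom_compose)
  then have h: "group_hom ?F (fun_group G (tuples G n)) (poly_fun G n \<circ> free_product_inr G ?F)"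
    by (intro group_hom.intro group_hom_axioms.intro group_free_group group_fun_group)
  fix b assume "b \<in> carrier ?F"
  have "(poly_fun G n \<circ> free_product_inr G ?F) b \<in> K"
  proof (rule free_group_hom_in_subgroup[OF h K _ \<open>b \<in> carrier ?F\<close>])
    show "(poly_fun G n \<circ> free_product_inr G ?F) (free_gen {1..n} i) \<in> K" if "i \<in> {1..n}" for i
      using coord[OF that] poly_fun_var[OF that] by (simp add: poly_var_def)
  qed
  then show "poly_fun G n (free_product_inr G ?F b) \<in> K" by simp
qed

lemma poly_fun_gens_subset: "poly_fun_gens G n \<subseteq> carrier (fun_group G (tuples G n))"
  unfolding poly_fun_gens_def using conj_orbit_subset[OF coordinate_closed] by (intro UN_least)

lemma carrier_poly_fun_group: "carrier (poly_fun_group G n) = poly_fun G n ` carrier (poly_group G n)"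
  by (simp add: poly_fun_group_def)

lemma carrier_poly_fun_group1:
  "carrier (poly_fun_group1 G n)
    = {p \<in> carrier (poly_fun_group G n). p (\<lambda>i\<in>{1..n}. \<one>) = \<one>}"
  by (simp add: poly_fun_group1_def)

lemma one_tuple: "(\<lambda>i\<in>{1..n}. \<one>) \<in> tuples G n"
  by (auto simp: tuples_def)

text \<open>A word in constants and coordinates can be rewritten with all constants moved to the right, which
  conjugates the coordinates they pass: every polynomial function is \<open>u\<close> times a constant, with \<open>u\<close>
  in the span of the conjugates of coordinates. All such \<open>u\<close> send the trivial tuple to \<open>1\<close>, so the
  functions that do this are those whose constant is \<open>1\<close>.\<close>

theorem carrier_poly_fun_group1_eq_generate:
  "carrier (poly_fun_group1 G n) = generate (fun_group G (tuples G n)) (poly_fun_gens G n)"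
proof -
  let ?X = "tuples G n" and ?e = "\<lambda>i\<in>{1..n}. \<one>"
  let ?F = "fun_group G ?X"
  let ?M = "generate ?F (poly_fun_gens G n)" and ?c = "\<lambda>a. \<lambda>t\<in>?X. a"
  interpret F: group ?F by (rule group_fun_group)
  interpret pf: group_hom "poly_group G n" ?F "poly_fun G n" by (rule group_hom_poly_fun)
  interpret e: group_hom ?F G "\<lambda>p. p ?e" by (rule group_hom_eval[OF one_tuple])
  note Mc = F.generate_in_carrier[OF poly_fun_gens_subset]
  have M: "subgroup ?M ?F" by (rule F.generate_is_subgroup[OF poly_fun_gens_subset])
  have cF: "?c a \<in> carrier ?F" if "a \<in> carrier G" for a using that by auto
  have conj: "conj_fun G ?X g u = ?c g \<otimes>\<^bsub>?F\<^esub> u \<otimes>\<^bsub>?F\<^esub> inv\<^bsub>?F\<^esub> ?c g" if "g \<in> carrier G" for g u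
    using cF[OF that] is_group that by (auto simp: conj_fun_def fun_eq_iff)
  have invariant: "?c g \<otimes>\<^bsub>?F\<^esub> u \<otimes>\<^bsub>?F\<^esub> inv\<^bsub>?F\<^esub> ?c g \<in> ?M" if "g \<in> carrier G" "u \<in> ?M" for g u
    unfolding conj[OF that(1), symmetric]
  proof (rule conj_fun_generate[OF that(1) poly_fun_gens_subset _ that(2)])
    fix a assume "a \<in> poly_fun_gens G n"
    then obtain i where "i \<in> {1..n}" "a \<in> conj_orbit G ?X (coordinate G n i)"
      by (auto simp: poly_fun_gens_def)
    then show "conj_fun G ?X g a \<in> ?M"
      using conj_fun_conj_orbit[OF that(1) coordinate_closed]
      unfolding poly_fun_gens_def by (intro generate.incl UN_I)
  qed
  let ?K = "{u \<otimes>\<^bsub>?F\<^esub> ?c a | u a. u \<in> ?M \<and> a \<in> carrier G}"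
  have K: "subgroup ?K ?F"
  proof
    show "?K \<subseteq> carrier ?F" using Mc cF F.m_closed by blast
    show "\<one>\<^bsub>?F\<^esub> \<in> ?K"
    proof -
      have "\<one>\<^bsub>?F\<^esub> = \<one>\<^bsub>?F\<^esub> \<otimes>\<^bsub>?F\<^esub> ?c \<one>" by (auto simp: fun_eq_iff)
      then show ?thesis using generate.one one_closed by blast
    qed
    fix x assume "x \<in> ?K"
    then obtain u a where x: "x = u \<otimes>\<^bsub>?F\<^esub> ?c a" "u \<in> ?M" "a \<in> carrier G" by blast
    note uF = Mc[OF x(2)] and aF = cF[OF x(3)]
    { fix y assume "y \<in> ?K"
      then obtain v b where y: "y = v \<otimes>\<^bsub>?F\<^esub> ?c b" "v \<in> ?M" "b \<in> carrier G" by blast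
      note vF = Mc[OF y(2)] and bF = cF[OF y(3)]
      let ?w = "?c a \<otimes>\<^bsub>?F\<^esub> v \<otimes>\<^bsub>?F\<^esub> inv\<^bsub>?F\<^esub> ?c a"
      have ab: "?c (a \<otimes> b) = ?c a \<otimes>\<^bsub>?F\<^esub> ?c b" by (auto simp: fun_eq_iff)
      have "x \<otimes>\<^bsub>?F\<^esub> y = u \<otimes>\<^bsub>?F\<^esub> ?c a \<otimes>\<^bsub>?F\<^esub> v \<otimes>\<^bsub>?F\<^esub> (inv\<^bsub>?F\<^esub> ?c a \<otimes>\<^bsub>?F\<^esub> ?c a) \<otimes>\<^bsub>?F\<^esub> ?c b"
        unfolding x(1) y(1) F.l_inv[OF aF] using uF vF aF bF
        by (simp only: F.m_assoc F.m_closed F.l_one F.one_closed)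
      also have "\<dots> = (u \<otimes>\<^bsub>?F\<^esub> ?w) \<otimes>\<^bsub>?F\<^esub> ?c (a \<otimes> b)"
        unfolding ab using uF vF aF bF by (simp only: F.m_assoc F.m_closed F.inv_closed)
      finally show "x \<otimes>\<^bsub>?F\<^esub> y \<in> ?K"
        using generate.eng[OF x(2) invariant[OF x(3) y(2)]] m_closed[OF x(3) y(3)] by blast }
    let ?w = "?c (inv a) \<otimes>\<^bsub>?F\<^esub> inv\<^bsub>?F\<^esub> u \<otimes>\<^bsub>?F\<^esub> inv\<^bsub>?F\<^esub> ?c (inv a)"
    have ia: "inv\<^bsub>?F\<^esub> ?c a = ?c (inv a)" using x(3) is_group by (auto simp: fun_eq_iff)
    have iaF: "?c (inv a) \<in> carrier ?F" by (rule cF[OF inv_closed[OF x(3)]])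
    have "inv\<^bsub>?F\<^esub> x = ?c (inv a) \<otimes>\<^bsub>?F\<^esub> inv\<^bsub>?F\<^esub> u \<otimes>\<^bsub>?F\<^esub> (inv\<^bsub>?F\<^esub> ?c (inv a) \<otimes>\<^bsub>?F\<^esub> ?c (inv a))"
      unfolding x(1) F.inv_mult_group[OF uF aF] ia F.l_inv[OF iaF] using F.inv_closed[OF uF] iaF
      by (simp only: F.m_closed F.r_one)
    also have "\<dots> = ?w \<otimes>\<^bsub>?F\<^esub> ?c (inv a)"
      using F.inv_closed[OF uF] iaF by (simp only: F.m_assoc F.m_closed F.inv_closed)
    finally show "inv\<^bsub>?F\<^esub> x \<in> ?K"
      using invariant[OF inv_closed[OF x(3)] subgroup.m_inv_closed[OF M x(2)]] inv_closed[OF x(3)] by blast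
  qed
  have coordM: "coordinate G n i \<in> ?M" if "i \<in> {1..n}" for i
    using that self_in_conj_orbit[OF coordinate_closed[OF that]]
    by (intro generate.incl) (auto simp: poly_fun_gens_def)
  have polyK: "poly_fun G n Z \<in> ?K" if "Z \<in> carrier (poly_group G n)" for Z
  proof (rule poly_fun_in_subgroup[OF K _ _ that])
    show "?c a \<in> ?K" if "a \<in> carrier G" for a
      using generate.one[of ?F "poly_fun_gens G n"] F.l_one[OF cF[OF that], symmetric] that by blast
    show "coordinate G n i \<in> ?K" if "i \<in> {1..n}" for i
    proof -
      have "?c \<one> = \<one>\<^bsub>?F\<^esub>" by simp
      then have "coordinate G n i = coordinate G n i \<otimes>\<^bsub>?F\<^esub> ?c \<one>"
        using F.r_one[OF coordinate_closed[OF that]] by simp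
      then show ?thesis using coordM[OF that] one_closed by blast
    qed
  qed
  have M1: "u ?e = \<one>" if "u \<in> ?M" for u
  proof -
    have "?M \<subseteq> kernel ?F G (\<lambda>p. p ?e)"
    proof (rule F.generate_subgroup_incl[OF _ e.subgroup_kernel], rule subsetI)
      fix p assume p: "p \<in> poly_fun_gens G n"
      then obtain i g where "i \<in> {1..n}" "g \<in> carrier G" "p = conj_fun G ?X g (coordinate G n i)"
        by (auto simp: poly_fun_gens_def conj_orbit_def)
      then have "p ?e = \<one>" using one_tuple by (simp add: conj_fun_def coordinate_def)
      then show "p \<in> kernel ?F G (\<lambda>p. p ?e)" using p poly_fun_gens_subset by (auto simp: kernel_def)
    qed
    then show ?thesis using that by (auto simp: kernel_def)
  qed
  show ?thesis
  proof
    show "carrier (poly_fun_group1 G n) \<subseteq> ?M"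
    proof
      fix p assume p: "p \<in> carrier (poly_fun_group1 G n)"
      then obtain u a where ua: "p = u \<otimes>\<^bsub>?F\<^esub> ?c a" "u \<in> ?M" "a \<in> carrier G"
        using polyK unfolding carrier_poly_fun_group1 carrier_poly_fun_group by blast
      have "p ?e = \<one>" using p by (simp add: carrier_poly_fun_group1)
      then have "a = \<one>" using ua(1,3) M1[OF ua(2)] one_tuple by simp
      then have "p = u \<otimes>\<^bsub>?F\<^esub> \<one>\<^bsub>?F\<^esub>" using ua(1) by simp
      then have "p = u" using F.r_one[OF Mc[OF ua(2)]] by metis
      then show "p \<in> ?M" using ua(2) by simp
    qed
    have "poly_fun_gens G n \<subseteq> carrier (poly_fun_group G n)"
    proof
      fix p assume "p \<in> poly_fun_gens G n"
      then obtain i g where ig: "i \<in> {1..n}" "g \<in> carrier G" "p = conj_fun G ?X g (coordinate G n i)"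
        by (auto simp: poly_fun_gens_def conj_orbit_def)
      let ?P = "poly_group G n"
      have "p = poly_fun G n (poly_const G n g \<otimes>\<^bsub>?P\<^esub> poly_var G n i \<otimes>\<^bsub>?P\<^esub> inv\<^bsub>?P\<^esub> poly_const G n g)"
        unfolding ig(3) conj[OF ig(2)] poly_fun_const[OF ig(2), symmetric] poly_fun_var[OF ig(1), symmetric]
        using poly_const_closed[OF ig(2)] poly_var_closed[OF ig(1)]
        by (simp only: pf.hom_mult pf.hom_inv pf.G.m_closed pf.G.inv_closed)
      then show "p \<in> carrier (poly_fun_group G n)"
        unfolding carrier_poly_fun_group
      proof (rule image_eqI)
        show "poly_const G n g \<otimes>\<^bsub>?P\<^esub> poly_var G n i \<otimes>\<^bsub>?P\<^esub> inv\<^bsub>?P\<^esub> poly_const G n g \<in> carrier ?P"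
          using poly_const_closed[OF ig(2)] poly_var_closed[OF ig(1)] by simp
      qed
    qed
    then have "?M \<subseteq> carrier (poly_fun_group G n)"
      by (rule F.generate_subgroup_incl[OF _ subgroup_poly_fun_group])
    then show "?M \<subseteq> carrier (poly_fun_group1 G n)"
      using M1 by (auto simp: carrier_poly_fun_group1)
  qed
qed

lemma poly_fun_group1_eq:
  "poly_fun_group1 G n
    = (fun_group G (tuples G n))\<lparr>carrier := generate (fun_group G (tuples G n)) (poly_fun_gens G n)\<rparr>"
  unfolding carrier_poly_fun_group1_eq_generate[symmetric]
  by (simp add: poly_fun_group1_def poly_fun_group_def)

lemma finitely_generated_poly_fun_group1_iff:
  "finitely_generated_group (poly_fun_group1 G n)
    \<longleftrightarrow> fg_subgroup (fun_group G (tuples G n)) (generate (fun_group G (tuples G n)) (poly_fun_gens G n))"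
  unfolding poly_fun_group1_eq
  by (intro group.finitely_generated_group_subgroup_iff group_fun_group group.generate_is_subgroup
      poly_fun_gens_subset)

lemma solvable_poly_fun_group1_iff:
  "solvable (poly_fun_group1 G n)
    \<longleftrightarrow> solvable_seq (fun_group G (tuples G n)) (generate (fun_group G (tuples G n)) (poly_fun_gens G n))"
  unfolding poly_fun_group1_eq
  by (intro group.solvable_subgroup_iff group_fun_group group.generate_is_subgroup poly_fun_gens_subset)

text \<open>Evaluation at the tuple \<open>(s, 1, ..., 1)\<close> sends the conjugates of the first coordinate to the
  conjugates of \<open>s\<close> and those of the other coordinates to \<open>1\<close>.\<close>

lemma eval_poly_fun_group1:
  assumes "n > 0" "s \<in> carrier G"
  obtains t where "t \<in> tuples G n"
    "(\<lambda>p. p t) ` generate (fun_group G (tuples G n)) (poly_fun_gens G n) = normal_closure G {s}"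
proof
  let ?X = "tuples G n" and ?t = "\<lambda>i\<in>{1..n}. if i = 1 then s else \<one>"
  show t: "?t \<in> ?X" using assms(2) by (auto simp: tuples_def)
  interpret e: group_hom "fun_group G ?X" G "\<lambda>p. p ?t" by (rule group_hom_eval[OF t])
  let ?c = "\<Union>g\<in>carrier G. (\<lambda>a. g \<otimes> a \<otimes> inv g) ` {s}"
  have val: "conj_fun G ?X g (coordinate G n i) ?t = g \<otimes> (if i = 1 then s else \<one>) \<otimes> inv g"
    if "i \<in> {1..n}" for g i
    using t that by (simp add: conj_fun_def coordinate_def)
  have img: "(\<lambda>p. p ?t) ` poly_fun_gens G n
      = (\<Union>i\<in>{1..n}. \<Union>g\<in>carrier G. {g \<otimes> (if i = 1 then s else \<one>) \<otimes> inv g})"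
    unfolding poly_fun_gens_def conj_orbit_def image_UN image_image using val by (auto intro!: SUP_cong)
  have "generate G ((\<lambda>p. p ?t) ` poly_fun_gens G n) = generate G ?c"
  proof (rule generate_eqI)
    show "(\<lambda>p. p ?t) ` poly_fun_gens G n \<subseteq> carrier G" using poly_fun_gens_subset e.hom_closed by blast
    show "?c \<subseteq> carrier G" using assms(2) by auto
    show "(\<lambda>p. p ?t) ` poly_fun_gens G n \<subseteq> generate G ?c"
      unfolding img
    proof (intro UN_least, simp only: insert_subset empty_subsetI simp_thms)
      fix i g assume "g \<in> carrier G" "i \<in> {1..n}"
      then show "g \<otimes> (if i = 1 then s else \<one>) \<otimes> inv g \<in> generate G ?c"
        by (cases "i = 1") (auto intro: generate.incl simp: generate.one)
    qed
    show "?c \<subseteq> generate G ((\<lambda>p. p ?t) ` poly_fun_gens G n)"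
    proof
      fix x assume "x \<in> ?c"
      then obtain g where g: "g \<in> carrier G" "x = g \<otimes> s \<otimes> inv g" by auto
      have "x \<in> (\<lambda>p. p ?t) ` poly_fun_gens G n"
        unfolding img using g assms(1) by (intro UN_I[of 1] UN_I[of g]) auto
      then show "x \<in> generate G ((\<lambda>p. p ?t) ` poly_fun_gens G n)" by (rule generate.incl)
    qed
  qed
  then show "(\<lambda>p. p ?t) ` generate (fun_group G ?X) (poly_fun_gens G n) = normal_closure G {s}"
    unfolding normal_closure_def e.generate_img[OF poly_fun_gens_subset] .
qed

end

section \<open>Polycyclic groups and polynomial functions\<close>

theorem theorem1p2:
  fixes G :: "('a, 'b) monoid_scheme" and n :: nat
  assumes "group G" and "finitely_generated_group G" and "n > 0"
  shows "polycyclic_group G \<longleftrightarrow>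
    finitely_generated_group (poly_fun_group1 G n) \<and> solvable (poly_fun_group1 G n)"
proof -
  interpret group G by fact
  let ?X = "tuples G n"
  let ?F = "fun_group G ?X"
  let ?M = "generate ?F (poly_fun_gens G n)"
  interpret F: group ?F by (rule group_fun_group)
  have M: "subgroup ?M ?F" by (rule F.generate_is_subgroup[OF poly_fun_gens_subset])
  show ?thesis
    unfolding finitely_generated_poly_fun_group1_iff solvable_poly_fun_group1_iff
  proof (intro iffI conjI; (elim conjE)?)
    assume "polycyclic_group G"
    then have solv: "solvable G" and noeth: "noetherian_group G" by (simp_all add: polycyclic_group_def)
    show "solvable_seq ?F ?M" by (rule F.solvable_subgroup[OF M solvable_fun_group[OF solv]])
    obtain d where d: "(derived G ^^ d) (carrier G) = {\<one>\<^bsub>G\<^esub>}"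
      using solv solvable_iff_trivial_derived_seq by blast
    show "fg_subgroup ?F ?M"
      unfolding poly_fun_gens_def
    proof (rule F.fg_subgroup_generate_Union)
      fix i assume i: "i \<in> {1..n}"
      show "conj_orbit G ?X (coordinate G n i) \<subseteq> carrier ?F"
        by (rule conj_orbit_subset[OF coordinate_closed[OF i]])
      show "fg_subgroup ?F (generate ?F (conj_orbit G ?X (coordinate G n i)))"
        using coordinate_closed[OF i]
        by (intro fg_subgroup_generate_conj_orbit[OF noeth normal_self d]) simp
    qed simp
  next
    assume fg: "fg_subgroup ?F ?M" and solv: "solvable_seq ?F ?M"
    show "polycyclic_group G"
    proof (rule polycyclic_groupI[OF assms(2)])
      fix s assume s: "s \<in> carrier G"
      obtain t where t: "t \<in> ?X" "(\<lambda>p. p t) ` ?M = normal_closure G {s}"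
        by (rule eval_poly_fun_group1[OF assms(3) s])
      interpret e: group_hom ?F G "\<lambda>p. p t" by (rule group_hom_eval[OF t(1)])
      show "fg_subgroup G (normal_closure G {s})" using e.fg_subgroup_img[OF fg] t(2) by simp
      show "solvable_seq G (normal_closure G {s})" using e.solvable_imp_solvable_img[OF solv] t(2) by simp
    qed
  qed
qed

end
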